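(* Let $\alpha>0$. The set of absolute values of the points of $\mathcal X_\infty^{(\alpha)}$ has the same distribution as $\{R_1,R_2,\dots\}$, where $R_k^\alpha\sim\mathrm{Gamma}(\frac2\alpha k,1)$ and all the $R_k$ are independent.
   Context: For $\alpha>0$, $\mathcal X_\infty^{(\alpha)}$ is the determinantal point process in $\mathbb C$ with kernel $\mathbb K_\infty^{(\alpha)}(z,w)=\frac{\alpha}{2\pi}E_{\frac2\alpha,\frac2\alpha}(z\bar w)e^{-\frac{|z|^\alpha}{2}-\frac{|w|^\alpha}{2}}$ with respect to Lebesgue measure $m$ on $\mathbb C$, where $E_{a,b}(z)=\sum_{k=0}^\infty \frac{z^k}{\Gamma(ak+b)}$ is the Mittag-Leffler function. That is, it is a simple point process whose joint intensities (correlation functions) with respect to $m$ are $\rho_k(x_1,\dots,x_k)=\det(\mathbb K_\infty^{(\alpha)}(x_i,x_j))_{1\le i,j\le k}$ for every $k\ge 1$. $\mathrm{Gamma}(a,1)$ is the distribution with density $\frac1{\Gamma(a)}e^{-x}x^{a-1}$ on $(0,\infty)$; the $R_k$ are positive random variables. *)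

theory Defs
  imports "HOL-Probability.Probability" "Jordan_Normal_Form.Determinant"
begin

text \<open>
  The measurable space of subsets of \<open>'a\<close>, with the smallest \<open>\<sigma>\<close>-algebra for which all the counts
  \<open>A \<mapsto> #(A \<inter> B)\<close>, \<open>B\<close> Borel, are measurable (compare \<^const>\<open>subprob_algebra\<close>). Its space
  deliberately consists of all subsets: a random set that is only almost surely locally finite,
  such as the range of a sequence of random variables, then still has a law, and on the locally
  finite subsets the trace is the usual \<open>\<sigma>\<close>-algebra of the configuration space.
\<close>

definition config_space :: "'a::topological_space set measure" where
  "config_space =
    (SUP B\<in>sets borel. vimage_algebra UNIV (\<lambda>A. emeasure (count_space UNIV) (A \<inter> B)) borel)"

definition simple_point_process :: "'w measure \<Rightarrow> ('w \<Rightarrow> 'a::topological_space set) \<Rightarrow> bool" where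
  "simple_point_process M X \<longleftrightarrow>
     prob_space M \<and> X \<in> M \<rightarrow>\<^sub>M config_space \<and>
     (\<forall>\<omega>\<in>space M. \<forall>C. compact C \<longrightarrow> finite (X \<omega> \<inter> C))"

text \<open>
  The \<open>k\<close>-point intensity is tested on pairwise disjoint Borel sets, which says nothing about the
  diagonals; as usual it is required to vanish there. The points \<open>x\<^sub>1, \<dots>, x\<^sub>k\<close> are indexed by
  \<open>{..<k}\<close>.
\<close>

definition joint_intensities ::
    "'w measure \<Rightarrow> 'a::topological_space measure \<Rightarrow> ('w \<Rightarrow> 'a set) \<Rightarrow>
     (nat \<Rightarrow> (nat \<Rightarrow> 'a) \<Rightarrow> real) \<Rightarrow> bool" where
  "joint_intensities M \<mu> X \<rho> \<longleftrightarrow>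
    (\<forall>k\<ge>1.
       \<rho> k \<in> borel_measurable (PiM {..<k} (\<lambda>_. \<mu>)) \<and>
       (\<forall>x\<in>space (PiM {..<k} (\<lambda>_. \<mu>)). 0 \<le> \<rho> k x \<and> (\<not> inj_on x {..<k} \<longrightarrow> \<rho> k x = 0)) \<and>
       (\<forall>D. (\<forall>i<k. D i \<in> sets borel) \<and> disjoint_family_on D {..<k} \<longrightarrow>
          (\<integral>\<^sup>+\<omega>. (\<Prod>i<k. emeasure (count_space UNIV) (X \<omega> \<inter> D i)) \<partial>M) =
          (\<integral>\<^sup>+x\<in>PiE {..<k} D. ennreal (\<rho> k x) \<partial>PiM {..<k} (\<lambda>_. \<mu>))))"

text \<open>
  The determinants are complex numbers a priori; that they are nonnegative reals is part of the
  requirement that they be joint intensities.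
\<close>

definition determinantal_point_process ::
    "'w measure \<Rightarrow> 'a::topological_space measure \<Rightarrow> ('a \<Rightarrow> 'a \<Rightarrow> complex) \<Rightarrow> ('w \<Rightarrow> 'a set) \<Rightarrow> bool" where
  "determinantal_point_process M \<mu> K X \<longleftrightarrow>
     simple_point_process M X \<and>
     (\<exists>\<rho>. joint_intensities M \<mu> X \<rho> \<and>
        (\<forall>k\<ge>1. \<forall>x\<in>space (PiM {..<k} (\<lambda>_. \<mu>)).
           complex_of_real (\<rho> k x) = Determinant.det (Matrix.mat k k (\<lambda>(i, j). K (x i) (x j)))))"

definition mittag_leffler :: "real \<Rightarrow> real \<Rightarrow> complex \<Rightarrow> complex" where
  "mittag_leffler a b z = (\<Sum>k. z ^ k / complex_of_real (Gamma (a * real k + b)))"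

definition mittag_leffler_kernel :: "real \<Rightarrow> complex \<Rightarrow> complex \<Rightarrow> complex" where
  "mittag_leffler_kernel \<alpha> z w =
     complex_of_real (\<alpha> / (2 * pi)) * mittag_leffler (2 / \<alpha>) (2 / \<alpha>) (z * cnj w) *
     complex_of_real (exp (- (norm z powr \<alpha>) / 2 - (norm w powr \<alpha>) / 2))"

definition gamma_density :: "real \<Rightarrow> real \<Rightarrow> real" where
  "gamma_density a x = (if x > 0 then exp (- x) * x powr (a - 1) / Gamma a else 0)"

end

theory Submission imports Defs begin

text \<open>
  Write \<open>K\<close> for the Mittag-Leffler kernel. It expands as
  \<open>K z w = (\<Sum>n. \<phi>\<^sub>n z * cnj (\<phi>\<^sub>n w))\<close>, where \<open>\<phi>\<^sub>n z\<close> is a constant multiple of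
  \<open>z ^ n * exp (- (norm z powr \<alpha>) / 2)\<close>. On a rotation-invariant set \<open>D = norm -` B\<close> the functions
  \<open>\<phi>\<^sub>n\<close> are orthogonal, because the Lebesgue measure is invariant under rotations, and the integral
  of \<open>norm (\<phi>\<^sub>n z) ^ 2\<close> over \<open>D\<close> is, in polar coordinates, the probability \<open>l n\<close> that
  \<open>R (Suc n)\<close> lies in \<open>B\<close>.

  The law of a random set of reals is determined by the probabilities that it misses a bounded Borel
  set \<open>B\<close> (\<open>distr_config_space_real_eqI\<close>): the number of points of any set \<open>A\<close> in \<open>B\<close> is
  the supremum, over the dyadic partitions, of the number of cells that meet \<open>A \<inter> B\<close>, and the
  missing events are stable under intersection. No statement about multiplicities is therefore
  needed; in particular it is not necessary to know that distinct points have distinct absolute values.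

  The set of absolute values misses \<open>B\<close> iff the process misses \<open>D\<close>, and the set of the
  \<open>R k\<close> misses \<open>B\<close> iff the set of indices \<open>n\<close> with \<open>R (Suc n) \<in> B\<close> is empty. In both
  cases the probability that a random set is empty is an alternating series in its factorial moments,
  that is, in the expected numbers of \<open>k\<close>-tuples of distinct elements
  (\<open>emeasure_empty_eq_alternating_sum\<close>). The factorial moments of the two sets are the same, namely
  the sums of \<open>\<Prod>i<k. l (g i)\<close> over all injective tuples \<open>g\<close> of indices: for the indices this is
  independence (\<open>factorial_moment_indep_events\<close>); for the process the \<open>k\<close>-th factorial moment is
  the integral of the intensity over \<open>D ^ k\<close> (\<open>factorial_moment_eq_integral\<close>), and
  the integral of the determinant is evaluated by expanding it into products of the orthogonal
  functions (\<open>LIMSEQ_integral_det_kernel\<close>).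
\<close>

section \<open>Random sets and their missing probabilities\<close>

lemma space_config_space [simp]: "space config_space = UNIV"
  by (auto simp: config_space_def space_Sup_eq_UN)

lemma measurable_config_space_count:
  "B \<in> sets borel \<Longrightarrow>
    (\<lambda>A. emeasure (count_space UNIV) (A \<inter> B)) \<in> borel_measurable config_space"
  unfolding config_space_def
  by (rule measurable_SUP1[of B]) (auto intro!: measurable_vimage_algebra1)

lemma measurable_config_spaceI:
  assumes "\<And>B. B \<in> sets borel \<Longrightarrow>
    (\<lambda>\<omega>. emeasure (count_space UNIV) (f \<omega> \<inter> B)) \<in> borel_measurable M"
  shows "f \<in> M \<rightarrow>\<^sub>M config_space"
  unfolding config_space_def
  by (rule measurable_SUP2) (auto intro!: measurable_vimage_algebra2 assms)

lemma sets_config_space_void: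
  assumes "B \<in> sets borel"
  shows "{A. A \<inter> B = {}} \<in> sets config_space"
proof -
  have "{A. A \<inter> B = {}} =
      (\<lambda>A. emeasure (count_space UNIV) (A \<inter> B)) -` {0} \<inter> space config_space"
    by (auto simp: emeasure_count_space_eq_0)
  also have "\<dots> \<in> sets config_space"
    by (rule measurable_sets[OF measurable_config_space_count[OF assms]]) auto
  finally show ?thesis .
qed

text \<open>
  A sequence of partitions, each refining the previous one, that separates points. The \<open>m\<close>-th
  partition is given by a labelling \<open>c m\<close>; its cells are the sets \<open>c m -` {j}\<close>.
\<close>
definition refining_cells :: "(nat \<Rightarrow> 'a \<Rightarrow> 'c) \<Rightarrow> bool" where
  "refining_cells c \<longleftrightarrow> (\<forall>m x y. c (Suc m) x = c (Suc m) y \<longrightarrow> c m x = c m y) \<and>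
     (\<forall>x y. x \<noteq> y \<longrightarrow> (\<exists>m. c m x \<noteq> c m y))"

lemma refining_cells_mono:
  assumes "refining_cells c" "c n x = c n y" "m \<le> n"
  shows "c m x = c m y"
  using assms(3,2)
proof (induction n rule: dec_induct)
  case (step n)
  have "c n x = c n y" using assms(1) step.prems unfolding refining_cells_def by blast
  then show ?case by (rule step.IH)
qed

lemma refining_cells_inj_on_mono:
  assumes "refining_cells c" "inj_on (\<lambda>i. c m (x i)) I" "m \<le> n"
  shows "inj_on (\<lambda>i. c n (x i)) I"
  using assms refining_cells_mono unfolding inj_on_def by metis

lemma refining_cells_separate:
  assumes c: "refining_cells c" and "finite I" "inj_on x I"
  shows "\<exists>m. inj_on (\<lambda>i. c m (x i)) I"
proof -
  have "\<exists>m. i \<noteq> j \<longrightarrow> c m (x i) \<noteq> c m (x j)" if "i \<in> I" "j \<in> I" for i j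
    using c that assms(3) unfolding refining_cells_def inj_on_def by metis
  then obtain f where f: "\<And>i j. i \<in> I \<Longrightarrow> j \<in> I \<Longrightarrow> i \<noteq> j \<Longrightarrow> c (f i j) (x i) \<noteq> c (f i j) (x j)"
    by metis
  define m where "m = Max (insert 0 ((\<lambda>(i, j). f i j) ` (I \<times> I)))"
  have "f i j \<le> m" if "i \<in> I" "j \<in> I" for i j
    unfolding m_def by (rule Max_ge) (use that assms(2) in auto)
  then have "inj_on (\<lambda>i. c m (x i)) I"
    using f refining_cells_mono[OF c] unfolding inj_on_def by metis
  then show ?thesis ..
qed

text \<open>
  The number of points of \<open>A\<close> is the limit of the number of occupied cells. As this holds for
  every set \<open>A\<close>, also an infinite one, no local finiteness is needed below.
\<close>
lemma count_space_eq_SUP_cells: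
  assumes c: "refining_cells c"
  shows "emeasure (count_space UNIV) A = (SUP m. emeasure (count_space UNIV) (c m ` A))"
proof (rule antisym)
  have fin: "of_nat (card F) \<le> (SUP m. emeasure (count_space UNIV) (c m ` A))"
    if F: "finite F" "F \<subseteq> A" for F
  proof -
    obtain m where m: "inj_on (c m) F"
      using refining_cells_separate[OF c F(1), of "\<lambda>x. x"] by auto
    have "of_nat (card F) = emeasure (count_space UNIV) (c m ` F)"
      using F by (simp add: card_image[OF m])
    also have "\<dots> \<le> emeasure (count_space UNIV) (c m ` A)"
      using F by (intro emeasure_mono) auto
    also have "\<dots> \<le> (SUP m. emeasure (count_space UNIV) (c m ` A))"
      by (rule SUP_upper) auto
    finally show ?thesis .
  qed
  show "emeasure (count_space UNIV) A \<le> (SUP m. emeasure (count_space UNIV) (c m ` A))"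
  proof (cases "finite A")
    case True
    then show ?thesis using fin[of A] by simp
  next
    case False
    have "of_nat n \<le> (SUP m. emeasure (count_space UNIV) (c m ` A))" for n
      using infinite_arbitrarily_large[OF False, of n] fin by auto
    then have "(SUP m. emeasure (count_space UNIV) (c m ` A)) = \<top>"
      by (meson ennreal_Ex_less_of_nat less_le_not_le top.not_eq_extremum)
    show ?thesis unfolding \<open>_ = \<top>\<close> by (rule top_greatest)
  qed
  show "(SUP m. emeasure (count_space UNIV) (c m ` A)) \<le> emeasure (count_space UNIV) A"
  proof (rule SUP_least)
    fix m
    show "emeasure (count_space UNIV) (c m ` A) \<le> emeasure (count_space UNIV) A"
      by (cases "finite A") (auto simp: card_image_le)
  qed
qed

lemma emeasure_count_space_image:
  assumes "inj h"
  shows "emeasure (count_space UNIV) (h ` A) = emeasure (count_space UNIV) A"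
  using assms inj_on_subset[OF assms subset_UNIV, of A]
  by (cases "finite A") (simp_all add: card_image finite_image_iff)

text \<open>
  The label of the half-open dyadic interval of length \<open>1 / 2 ^ m\<close> that contains \<open>x\<close>.
\<close>
definition dyadic_cell :: "nat \<Rightarrow> real \<Rightarrow> int" where
  "dyadic_cell m x = \<lfloor>2 ^ m * x\<rfloor>"

lemma refining_dyadic_cell: "refining_cells dyadic_cell"
  unfolding refining_cells_def
proof (intro conjI allI impI)
  fix m x y assume "dyadic_cell (Suc m) x = dyadic_cell (Suc m) y"
  moreover have "\<lfloor>2 ^ m * z\<rfloor> = \<lfloor>2 ^ Suc m * z\<rfloor> div 2" for z :: real
    using floor_divide_real_eq_div[of 2 "2 ^ Suc m * z"] by simp
  ultimately show "dyadic_cell m x = dyadic_cell m y"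
    by (simp add: dyadic_cell_def)
next
  fix x y :: real assume "x \<noteq> y"
  then obtain m where m: "1 / \<bar>x - y\<bar> < 2 ^ m"
    using real_arch_pow[of 2 "1 / \<bar>x - y\<bar>"] by auto
  have "1 < \<bar>2 ^ m * x - 2 ^ m * y\<bar>"
    using m \<open>x \<noteq> y\<close> unfolding right_diff_distrib[symmetric] abs_mult
    by (simp add: pos_divide_less_eq mult.commute)
  then have "dyadic_cell m x \<noteq> dyadic_cell m y"
    unfolding dyadic_cell_def by linarith
  then show "\<exists>m. dyadic_cell m x \<noteq> dyadic_cell m y" ..
qed

lemma bounded_dyadic_cell: "bounded (dyadic_cell m -` {i})"
proof (rule bounded_subset)
  show "bounded {of_int i / 2 ^ m .. (of_int i + 1) / 2 ^ m :: real}" by simp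
  show "dyadic_cell m -` {i} \<subseteq> {of_int i / 2 ^ m .. (of_int i + 1) / 2 ^ m :: real}"
  proof
    fix x assume "x \<in> dyadic_cell m -` {i}"
    then have "of_int i \<le> 2 ^ m * x" "2 ^ m * x < of_int i + 1"
      unfolding dyadic_cell_def by (auto simp: floor_eq_iff)
    then show "x \<in> {of_int i / 2 ^ m .. (of_int i + 1) / 2 ^ m}"
      by (simp add: field_simps)
  qed
qed

lemma sets_dyadic_cell: "dyadic_cell m -` {i} \<in> sets borel"
proof -
  have [measurable]: "dyadic_cell m \<in> borel \<rightarrow>\<^sub>M count_space UNIV"
    unfolding dyadic_cell_def by measurable
  have "dyadic_cell m -` {i} \<inter> space borel \<in> sets borel" by measurable
  then show ?thesis by simp
qed

text \<open>
  Counts are recovered from missing events only: a cell is occupied iff its intersection with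
  \<open>B\<close> is not missed. Bounded test sets are enough because dyadic cells are bounded.
\<close>
lemma measurable_config_space_real_void:
  fixes f :: "'w \<Rightarrow> real set"
  assumes void: "\<And>B. B \<in> sets borel \<Longrightarrow> bounded B \<Longrightarrow> {\<omega>\<in>space M. f \<omega> \<inter> B = {}} \<in> sets M"
  shows "f \<in> M \<rightarrow>\<^sub>M config_space"
proof (rule measurable_config_spaceI)
  fix B :: "real set" assume B: "B \<in> sets borel"
  define P where "P m i \<omega> \<longleftrightarrow> f \<omega> \<inter> (B \<inter> dyadic_cell m -` {from_nat_into UNIV i}) \<noteq> {}" for m i \<omega>
  have [measurable]: "Measurable.pred M (P m i)" for m i
  proof -
    have "{\<omega>\<in>space M. \<not> P m i \<omega>} \<in> sets M"
      unfolding P_def not_not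
      by (rule void) (use B sets_dyadic_cell bounded_dyadic_cell in \<open>auto intro: bounded_subset\<close>)
    then have "space M - {\<omega>\<in>space M. \<not> P m i \<omega>} \<in> sets M" by (rule sets.compl_sets)
    moreover have "space M - {\<omega>\<in>space M. \<not> P m i \<omega>} = {\<omega>\<in>space M. P m i \<omega>}" by blast
    ultimately show ?thesis by (simp add: pred_def)
  qed
  have count: "emeasure (count_space UNIV) (dyadic_cell m ` (f \<omega> \<inter> B)) =
      (\<Sum>i. if P m i \<omega> then 1 else 0)" for m \<omega>
  proof -
    have bij: "bij (from_nat_into (UNIV :: int set))"
      using bij_betw_from_nat_into[of "UNIV :: int set"] infinite_UNIV_int by auto
    have "dyadic_cell m ` (f \<omega> \<inter> B) = from_nat_into UNIV ` {i. P m i \<omega>}"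
    proof
      show "dyadic_cell m ` (f \<omega> \<inter> B) \<subseteq> from_nat_into UNIV ` {i. P m i \<omega>}"
      proof
        fix j assume "j \<in> dyadic_cell m ` (f \<omega> \<inter> B)"
        moreover obtain i where "j = from_nat_into UNIV i"
          using bij by (metis bij_pointE)
        ultimately show "j \<in> from_nat_into UNIV ` {i. P m i \<omega>}"
          unfolding P_def by (intro image_eqI[of _ _ i]) auto
      qed
      show "from_nat_into UNIV ` {i. P m i \<omega>} \<subseteq> dyadic_cell m ` (f \<omega> \<inter> B)"
        unfolding P_def by (fastforce intro: rev_image_eqI)
    qed
    then have "emeasure (count_space UNIV) (dyadic_cell m ` (f \<omega> \<inter> B)) =
        emeasure (count_space UNIV) {i. P m i \<omega>}"
      using emeasure_count_space_image[OF bij_is_inj[OF bij]] by simp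
    also have "\<dots> = (\<integral>\<^sup>+i. indicator {i. P m i \<omega>} i \<partial>count_space UNIV)"
      by simp
    finally show ?thesis by (simp add: nn_integral_count_space_nat indicator_def of_bool_def)
  qed
  have "(\<lambda>\<omega>. emeasure (count_space UNIV) (f \<omega> \<inter> B)) =
      (\<lambda>\<omega>. SUP m. \<Sum>i. if P m i \<omega> then 1 else 0)"
    by (simp add: count_space_eq_SUP_cells[OF refining_dyadic_cell] count)
  also have "\<dots> \<in> borel_measurable M"
    by measurable
  finally show "(\<lambda>\<omega>. emeasure (count_space UNIV) (f \<omega> \<inter> B)) \<in> borel_measurable M" .
qed

lemma sets_config_space_real:
  "sets (config_space :: real set measure) =
    sigma_sets UNIV {{A. A \<inter> B = {}} | B. B \<in> sets borel \<and> bounded B}" (is "_ = sigma_sets UNIV ?G")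
proof
  have "(\<lambda>A. A) \<in> sigma UNIV ?G \<rightarrow>\<^sub>M config_space"
    by (rule measurable_config_space_real_void) auto
  then have "(\<lambda>A. A) -` E \<inter> space (sigma UNIV ?G) \<in> sets (sigma UNIV ?G)"
    if "E \<in> sets config_space" for E
    using that by (rule measurable_sets)
  then show "sets config_space \<subseteq> sigma_sets UNIV ?G" by auto
  show "sigma_sets UNIV ?G \<subseteq> sets (config_space :: real set measure)"
    using sets.sigma_sets_subset[of ?G "config_space :: real set measure"] sets_config_space_void by auto
qed

lemma distr_config_space_real_eqI:
  fixes f :: "'w \<Rightarrow> real set" and g :: "'v \<Rightarrow> real set"
  assumes M: "prob_space M" and f: "f \<in> M \<rightarrow>\<^sub>M config_space" and g: "g \<in> N \<rightarrow>\<^sub>M config_space"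
    and eq: "\<And>B. B \<in> sets borel \<Longrightarrow> bounded B \<Longrightarrow>
      emeasure M {\<omega>\<in>space M. f \<omega> \<inter> B = {}} = emeasure N {\<omega>\<in>space N. g \<omega> \<inter> B = {}}"
  shows "distr M config_space f = distr N config_space g"
proof (rule measure_eqI_generator_eq[where \<Omega>=UNIV and A="\<lambda>_. UNIV"
      and E="{{A. A \<inter> B = {}} | B. B \<in> sets borel \<and> bounded B}"])
  show "Int_stable {{A :: real set. A \<inter> B = {}} | B. B \<in> sets borel \<and> bounded B}"
  proof (rule Int_stableI)
    fix a b :: "real set set"
    assume "a \<in> {{A. A \<inter> B = {}} | B. B \<in> sets borel \<and> bounded B}"
      "b \<in> {{A. A \<inter> B = {}} | B. B \<in> sets borel \<and> bounded B}"
    then obtain B C where "B \<in> sets borel" "bounded B" "C \<in> sets borel" "bounded C"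
      "a = {A. A \<inter> B = {}}" "b = {A. A \<inter> C = {}}" by auto
    then show "a \<inter> b \<in> {{A. A \<inter> B = {}} | B. B \<in> sets borel \<and> bounded B}"
      by (intro CollectI exI[of _ "B \<union> C"]) auto
  qed
  fix E assume "E \<in> {{A :: real set. A \<inter> B = {}} | B. B \<in> sets borel \<and> bounded B}"
  then obtain B where B: "B \<in> sets borel" "bounded B" "E = {A. A \<inter> B = {}}" by auto
  show "emeasure (distr M config_space f) E = emeasure (distr N config_space g) E"
  proof -
    have "f -` E \<inter> space M = {\<omega>\<in>space M. f \<omega> \<inter> B = {}}" "g -` E \<inter> space N = {\<omega>\<in>space N. g \<omega> \<inter> B = {}}"
      using B(3) by auto
    then show ?thesis
      using eq[OF B(1,2)] sets_config_space_void[OF B(1)] B(3)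
      by (simp add: emeasure_distr[OF f] emeasure_distr[OF g])
  qed
next
  interpret M: prob_space M by fact
  show "emeasure (distr M config_space f) UNIV \<noteq> \<infinity>" for i :: nat
    using emeasure_distr[OF f, of UNIV] sets.top[of "config_space :: real set measure"] by simp
  have "(UNIV :: real set set) = {A. A \<inter> {} = {}} \<and> {} \<in> sets borel \<and> bounded {}" by simp
  then show "range (\<lambda>_. UNIV) \<subseteq> {{A :: real set. A \<inter> B = {}} | B. B \<in> sets borel \<and> bounded B}"
    by blast
  show "{{A :: real set. A \<inter> B = {}} | B. B \<in> sets borel \<and> bounded B} \<subseteq> Pow UNIV" by simp
  show "sets (distr M config_space f) = sigma_sets UNIV {{A :: real set. A \<inter> B = {}} | B. B \<in> sets borel \<and> bounded B}"
    "sets (distr N config_space g) = sigma_sets UNIV {{A :: real set. A \<inter> B = {}} | B. B \<in> sets borel \<and> bounded B}"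
    unfolding sets_distr by (rule sets_config_space_real)+
qed simp

text \<open>
  The label of the half-open dyadic square of side \<open>1 / 2 ^ m\<close> that contains \<open>z\<close>.
\<close>
definition complex_cell :: "nat \<Rightarrow> complex \<Rightarrow> int \<times> int" where
  "complex_cell m z = (dyadic_cell m (Re z), dyadic_cell m (Im z))"

lemma refining_complex_cell: "refining_cells complex_cell"
  using refining_dyadic_cell unfolding refining_cells_def complex_cell_def complex_eq_iff by blast

lemma sets_complex_cell: "complex_cell m -` {j} \<in> sets borel"
proof -
  have [measurable]: "dyadic_cell m \<in> borel \<rightarrow>\<^sub>M count_space UNIV"
    unfolding dyadic_cell_def by measurable
  have "{z \<in> space borel. dyadic_cell m (Re z) = fst j \<and> dyadic_cell m (Im z) = snd j} \<in> sets borel"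
    by measurable
  also have "{z \<in> space borel. dyadic_cell m (Re z) = fst j \<and> dyadic_cell m (Im z) = snd j} =
      complex_cell m -` {j}"
    by (cases j) (auto simp: complex_cell_def)
  finally show ?thesis .
qed

lemma finite_complex_cell:
  assumes "D \<subseteq> cball 0 r"
  shows "finite (complex_cell m ` D)"
proof (rule finite_subset)
  show "complex_cell m ` D \<subseteq> {\<lfloor>2 ^ m * (- r)\<rfloor>..\<lfloor>2 ^ m * r\<rfloor>} \<times> {\<lfloor>2 ^ m * (- r)\<rfloor>..\<lfloor>2 ^ m * r\<rfloor>}"
  proof
    fix j assume "j \<in> complex_cell m ` D"
    then obtain z where z: "j = complex_cell m z" "norm z \<le> r" using assms by (auto simp: dist_norm)
    have "- r \<le> Re z" "Re z \<le> r" "- r \<le> Im z" "Im z \<le> r"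
      using z(2) abs_Re_le_cmod[of z] abs_Im_le_cmod[of z] by linarith+
    then show "j \<in> {\<lfloor>2 ^ m * (- r)\<rfloor>..\<lfloor>2 ^ m * r\<rfloor>} \<times> {\<lfloor>2 ^ m * (- r)\<rfloor>..\<lfloor>2 ^ m * r\<rfloor>}"
      unfolding z(1) complex_cell_def dyadic_cell_def mem_Times_iff atLeastAtMost_iff fst_conv snd_conv
      by (intro conjI floor_mono mult_left_mono) simp_all
  qed
qed simp

section \<open>Factorial moments and the probability of being empty\<close>

text \<open>
  The \<open>k\<close>-tuples of distinct elements of \<open>S\<close>, as extensional functions on \<open>{..<k}\<close>.
  If \<open>S\<close> is finite, their number is the falling factorial of \<open>card S\<close>; the expectation of this
  number for a random set \<open>S\<close> is its \<open>k\<close>-th factorial moment.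
\<close>
definition inj_tuples :: "nat \<Rightarrow> 'a set \<Rightarrow> (nat \<Rightarrow> 'a) set" where
  "inj_tuples k S = {x \<in> {..<k} \<rightarrow>\<^sub>E S. inj_on x {..<k}}"

lemma inj_tuples_mono: "S \<subseteq> T \<Longrightarrow> inj_tuples k S \<subseteq> inj_tuples k T"
  unfolding inj_tuples_def using PiE_mono[of "{..<k}" "\<lambda>_. S" "\<lambda>_. T"] by blast

lemma finite_inj_tuples [simp]: "finite S \<Longrightarrow> finite (inj_tuples k S)"
  unfolding inj_tuples_def by (rule finite_subset[OF _ finite_PiE[of "{..<k}" "\<lambda>_. S"]]) auto

lemma prod_falling_eq_fact_choose: "(\<Prod>i<k. n - i) = fact k * (n choose k)" for n k :: nat
proof (induction k)
  case (Suc k)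
  have "(\<Prod>i<Suc k. n - i) = fact k * ((n - k) * (n choose k))"
    using Suc by (simp add: mult_ac)
  also have "\<dots> = fact k * (Suc k * (n choose Suc k))"
    unfolding binomial_absorb_comp binomial_absorption ..
  also have "\<dots> = fact (Suc k) * (n choose Suc k)"
    by (simp add: algebra_simps)
  finally show ?case .
qed simp

lemma card_inj_tuples:
  assumes "finite S"
  shows "card (inj_tuples k S) = fact k * (card S choose k)"
  using card_inj_on_subset_funcset[of "{..<k}" S "{..<k}"] assms
  by (simp add: inj_tuples_def prod_falling_eq_fact_choose atLeast0LessThan)

lemma emeasure_inj_tuples_1:
  "emeasure (count_space UNIV) (inj_tuples 1 S) = emeasure (count_space UNIV) S"
proof -
  let ?h = "\<lambda>s :: 'a. \<lambda>i\<in>{..<1::nat}. s"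
  have "inj ?h"
  proof (rule injI)
    fix s t :: 'a assume "?h s = ?h t"
    then show "s = t" by (auto dest: fun_cong[of _ _ 0])
  qed
  moreover have "inj_tuples 1 S = ?h ` S"
  proof (intro equalityI subsetI)
    fix x assume "x \<in> inj_tuples 1 S"
    then have x: "x \<in> {..<1} \<rightarrow>\<^sub>E S" by (simp add: inj_tuples_def)
    then have "x 0 \<in> S" by (rule PiE_mem) simp
    moreover have "x = ?h (x 0)"
      by (rule extensionalityI[of _ "{..<1}"]) (use x in \<open>auto simp: PiE_def\<close>)
    ultimately show "x \<in> ?h ` S" by blast
  next
    fix x assume "x \<in> ?h ` S"
    then obtain s where s: "s \<in> S" "x = ?h s" by blast
    then have "x \<in> {..<1} \<rightarrow>\<^sub>E S" by (intro PiE_I) simp_all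
    moreover have "inj_on x {..<1}" by (rule inj_onI) simp
    ultimately show "x \<in> inj_tuples 1 S" unfolding inj_tuples_def by blast
  qed
  ultimately show ?thesis by (simp only: emeasure_count_space_image)
qed

text \<open>
  For a finite set with \<open>n\<close> elements, \<open>\<Sum>k. (-1) ^ k * (n choose k)\<close> is \<open>1\<close> or \<open>0\<close>
  according to whether \<open>n = 0\<close>. Taking expectations gives the formula. The summability hypothesis
  says that \<open>2 ^ n\<close> is integrable and so permits the exchange of sum and integral. Finiteness of
  the first moment makes the random set almost surely finite.
\<close>
lemma (in prob_space) emeasure_empty_eq_alternating_sum:
  fixes S :: "'a \<Rightarrow> 'b set"
  assumes meas: "\<And>k. (\<lambda>\<omega>. emeasure (count_space UNIV) (inj_tuples k (S \<omega>))) \<in> borel_measurable M"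
    and moments: "\<And>k. (\<integral>\<^sup>+\<omega>. emeasure (count_space UNIV) (inj_tuples k (S \<omega>)) \<partial>M) = ennreal (f k)"
    and nonneg: "\<And>k. 0 \<le> f k"
    and summable: "summable (\<lambda>k. f k / fact k)"
  shows "emeasure M {\<omega>\<in>space M. S \<omega> = {}} = ennreal (\<Sum>k. (-1) ^ k * f k / fact k)"
proof -
  define c where "c k \<omega> = enn2real (emeasure (count_space UNIV) (inj_tuples k (S \<omega>)))" for k \<omega>
  have c_meas [measurable]: "c k \<in> borel_measurable M" for k
    unfolding c_def using meas[of k] by measurable
  have fin: "AE \<omega> in M. finite (S \<omega>)"
  proof -
    have "AE \<omega> in M. emeasure (count_space UNIV) (inj_tuples 1 (S \<omega>)) \<noteq> \<infinity>"
      by (rule nn_integral_PInf_AE[OF meas]) (simp add: moments)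
    then show ?thesis unfolding emeasure_inj_tuples_1
      by eventually_elim (auto simp: emeasure_count_space split: if_splits)
  qed
  have c_fin: "c k \<omega> = fact k * (card (S \<omega>) choose k)" if "finite (S \<omega>)" for k \<omega>
  proof -
    have "c k \<omega> = real (card (inj_tuples k (S \<omega>)))"
      using that by (simp add: c_def enn2real_of_nat)
    then show ?thesis using that by (simp add: card_inj_tuples)
  qed
  have nn: "(\<integral>\<^sup>+\<omega>. ennreal (c k \<omega>) \<partial>M) = ennreal (f k)" for k
  proof -
    have "(\<integral>\<^sup>+\<omega>. ennreal (c k \<omega>) \<partial>M) =
        (\<integral>\<^sup>+\<omega>. emeasure (count_space UNIV) (inj_tuples k (S \<omega>)) \<partial>M)"
    proof (rule nn_integral_cong_AE)
      show "AE \<omega> in M. ennreal (c k \<omega>) = emeasure (count_space UNIV) (inj_tuples k (S \<omega>))"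
        using fin by eventually_elim (simp add: c_def ennreal_of_nat_eq_real_of_nat)
    qed
    then show ?thesis by (simp add: moments)
  qed
  have c_int: "integrable M (c k)" and c_eq: "integral\<^sup>L M (c k) = f k" for k
  proof -
    have "0 \<le> c k \<omega>" for \<omega> by (simp add: c_def)
    then show "integrable M (c k)"
      by (intro integrableI_nn_integral_finite[OF _ _ nn]) auto
    show "integral\<^sup>L M (c k) = f k"
      using \<open>\<And>\<omega>. 0 \<le> c k \<omega>\<close> by (subst integral_eq_nn_integral) (auto simp: nn nonneg)
  qed
  define g where "g k \<omega> = (-1) ^ k * c k \<omega> / fact k" for k \<omega>
  have g_fin: "g k \<omega> = (-1) ^ k * (card (S \<omega>) choose k)" if "finite (S \<omega>)" for k \<omega>
    using that by (simp add: g_def c_fin)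
  have g_sum: "(\<Sum>k. g k \<omega>) = indicator {\<omega>\<in>space M. S \<omega> = {}} \<omega>"
    if "finite (S \<omega>)" "\<omega> \<in> space M" for \<omega>
  proof -
    have "(\<Sum>k. g k \<omega>) = (\<Sum>k\<le>card (S \<omega>). g k \<omega>)"
      by (rule suminf_finite) (auto simp: g_fin that)
    also have "\<dots> = (\<Sum>k\<le>card (S \<omega>). (-1) ^ k * of_nat (card (S \<omega>) choose k))"
      by (simp add: g_fin that)
    also have "\<dots> = indicator {\<omega>\<in>space M. S \<omega> = {}} \<omega>"
      using choose_alternating_sum[of "card (S \<omega>)", where 'a=real] that
      by (cases "card (S \<omega>) = 0") (auto simp: indicator_def)
    finally show ?thesis .
  qed
  have meas_empty: "{\<omega>\<in>space M. S \<omega> = {}} \<in> sets M"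
  proof -
    have "{\<omega>\<in>space M. S \<omega> = {}} =
        (\<lambda>\<omega>. emeasure (count_space UNIV) (inj_tuples 1 (S \<omega>))) -` {0} \<inter> space M"
      unfolding emeasure_inj_tuples_1 by (auto simp: emeasure_count_space_eq_0)
    then show ?thesis using measurable_sets[OF meas[of 1], of "{0}"] by simp
  qed
  have g_int: "integrable M (g k)" for k
    unfolding g_def using c_int by simp
  have "prob {\<omega>\<in>space M. S \<omega> = {}} = (\<integral>\<omega>. indicator {\<omega>\<in>space M. S \<omega> = {}} \<omega> \<partial>M)"
    using meas_empty by simp
  also have "\<dots> = (\<integral>\<omega>. (\<Sum>k. g k \<omega>) \<partial>M)"
  proof (rule integral_cong_AE)
    show "(\<lambda>\<omega>. \<Sum>k. g k \<omega>) \<in> borel_measurable M" unfolding g_def by measurable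
    show "AE \<omega> in M. indicator {\<omega>\<in>space M. S \<omega> = {}} \<omega> = (\<Sum>k. g k \<omega>)"
      using fin AE_space by eventually_elim (simp add: g_sum)
  qed (use meas_empty in auto)
  also have "\<dots> = (\<Sum>k. integral\<^sup>L M (g k))"
  proof (rule integral_suminf[OF g_int])
    show "AE \<omega> in M. summable (\<lambda>k. norm (g k \<omega>))"
      using fin
    proof eventually_elim
      case (elim \<omega>)
      show ?case by (rule summable_finite[of "{..card (S \<omega>)}"]) (auto simp: g_fin elim)
    qed
    have "(\<integral>\<omega>. norm (g k \<omega>) \<partial>M) = f k / fact k" for k
    proof -
      have "norm (g k \<omega>) = c k \<omega> / fact k" for \<omega>
        by (simp add: g_def c_def abs_mult)
      then show ?thesis by (simp add: c_eq)
    qed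
    then show "summable (\<lambda>k. \<integral>\<omega>. norm (g k \<omega>) \<partial>M)" using summable by simp
  qed
  also have "\<dots> = (\<Sum>k. (-1) ^ k * f k / fact k)"
    unfolding g_def by (simp add: c_eq)
  finally show ?thesis by (simp add: emeasure_eq_measure)
qed

section \<open>Integrals of determinants of kernels with an orthogonal expansion\<close>

text \<open>
  Leibniz expansion of the determinant of a kernel of finite rank. The factors
  \<open>cnj (\<psi> (g i) (x (p i)))\<close> are reindexed so that each factor of the product depends on a single
  coordinate of \<open>x\<close>.
\<close>
lemma det_finite_rank_kernel:
  fixes \<psi> :: "nat \<Rightarrow> 'a \<Rightarrow> complex"
  shows "Determinant.det (Matrix.mat k k (\<lambda>(i, j). \<Sum>n<N. \<psi> n (x i) * cnj (\<psi> n (x j)))) =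
    (\<Sum>g\<in>{..<k} \<rightarrow>\<^sub>E {..<N}. \<Sum>p | p permutes {..<k}. signof p *
       (\<Prod>i<k. \<psi> (g i) (x i) * cnj (\<psi> (g (inv_into UNIV p i)) (x i))))"
proof -
  have "(\<Prod>i<k. \<Sum>n<N. \<psi> n (x i) * cnj (\<psi> n (x (p i)))) =
      (\<Sum>g\<in>{..<k} \<rightarrow>\<^sub>E {..<N}. \<Prod>i<k. \<psi> (g i) (x i) * cnj (\<psi> (g (inv_into UNIV p i)) (x i)))"
    if p: "p permutes {..<k}" for p
  proof -
    have "(\<Prod>i<k. \<Sum>n<N. \<psi> n (x i) * cnj (\<psi> n (x (p i)))) =
        (\<Sum>g\<in>{..<k} \<rightarrow>\<^sub>E {..<N}. \<Prod>i<k. \<psi> (g i) (x i) * cnj (\<psi> (g i) (x (p i))))"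
      by (rule prod_sum_PiE) auto
    also have "\<dots> = (\<Sum>g\<in>{..<k} \<rightarrow>\<^sub>E {..<N}. \<Prod>i<k. \<psi> (g i) (x i) * cnj (\<psi> (g (inv_into UNIV p i)) (x i)))"
    proof (rule sum.cong[OF refl])
      fix g
      have "(\<Prod>i<k. cnj (\<psi> (g (inv_into UNIV p i)) (x i))) = (\<Prod>i<k. cnj (\<psi> (g i) (x (p i))))"
        by (subst prod.permute[OF p]) (simp add: o_def permutes_inverses[OF p])
      then show "(\<Prod>i<k. \<psi> (g i) (x i) * cnj (\<psi> (g i) (x (p i)))) =
          (\<Prod>i<k. \<psi> (g i) (x i) * cnj (\<psi> (g (inv_into UNIV p i)) (x i)))"
        by (simp only: prod.distrib)
    qed
    finally show ?thesis .
  qed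
  moreover have "Determinant.det (Matrix.mat k k (\<lambda>(i, j). \<Sum>n<N. \<psi> n (x i) * cnj (\<psi> n (x j)))) =
      (\<Sum>p | p permutes {..<k}. signof p * (\<Prod>i<k. \<Sum>n<N. \<psi> n (x i) * cnj (\<psi> n (x (p i)))))"
    by (subst det_def'[of _ k])
       (auto simp: atLeast0LessThan intro!: sum.cong prod.cong
             dest: permutes_in_image[of _ "{..<k}"])
  ultimately show ?thesis
    by (subst sum.swap) (simp add: sum_distrib_left)
qed

text \<open>
  The sum is the Leibniz formula for the matrix with entries \<open>of_bool (g i = g j)\<close>. This is the unit
  matrix if \<open>g\<close> is injective, and otherwise it has two equal rows.
\<close>
lemma sum_signof_stabilizer:
  fixes g :: "nat \<Rightarrow> nat"
  shows "(\<Sum>p | p permutes {..<k}. signof p * (\<Prod>i<k. of_bool (g i = g (inv_into UNIV p i)))) =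
    (of_bool (inj_on g {..<k}) :: complex)"
proof -
  let ?A = "Matrix.mat k k (\<lambda>(i, j). of_bool (g i = g j)) :: complex mat"
  have "(\<Sum>p | p permutes {..<k}. signof p * (\<Prod>i<k. of_bool (g i = g (inv_into UNIV p i)))) =
      (\<Sum>p | p permutes {..<k}. signof p * (\<Prod>i<k. of_bool (g i = g (p i))) :: complex)"
  proof (rule sum.cong[OF refl])
    fix p assume "p \<in> {p. p permutes {..<k}}"
    then have p: "p permutes {..<k}" by simp
    have "(\<Prod>i<k. of_bool (g i = g (inv_into UNIV p i))) = (\<Prod>i<k. of_bool (g i = g (p i)) :: complex)"
      by (subst prod.permute[OF p]) (simp add: o_def permutes_inverses[OF p] eq_commute)
    then show "signof p * (\<Prod>i<k. of_bool (g i = g (inv_into UNIV p i))) =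
        (signof p * (\<Prod>i<k. of_bool (g i = g (p i))) :: complex)" by simp
  qed
  also have "\<dots> = Determinant.det ?A"
    by (subst det_def'[of _ k])
       (auto simp: atLeast0LessThan intro!: sum.cong prod.cong
             dest: permutes_in_image[of _ "{..<k}"])
  also have "\<dots> = of_bool (inj_on g {..<k})"
  proof (cases "inj_on g {..<k}")
    case True
    then have "?A = 1\<^sub>m k"
      by (intro eq_matI) (auto simp: inj_on_def)
    then show ?thesis using True by simp
  next
    case False
    then obtain i j where ij: "i < k" "j < k" "i \<noteq> j" "g i = g j"
      by (auto simp: inj_on_def)
    have "Determinant.det ?A = 0"
      by (rule det_identical_rows[of _ k i j]) (use ij in auto)
    then show ?thesis using False by simp
  qed
  finally show ?thesis .
qed

text \<open>
  After integration of the Leibniz expansion, orthogonality leaves only the permutations that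
  stabilize \<open>g\<close>, whose signed number is \<open>1\<close> for an injective tuple and \<open>0\<close> otherwise.
\<close>
lemma (in sigma_finite_measure)
  fixes \<psi> :: "nat \<Rightarrow> 'a \<Rightarrow> complex"
  assumes int: "\<And>m n. integrable M (\<lambda>x. \<psi> m x * cnj (\<psi> n x))"
    and orth: "\<And>m n. (\<integral>x. \<psi> m x * cnj (\<psi> n x) \<partial>M) = of_bool (m = n) * l m"
  shows integrable_det_finite_rank_kernel: "integrable (PiM {..<k} (\<lambda>_. M)) (\<lambda>x.
      Determinant.det (Matrix.mat k k (\<lambda>(i, j). \<Sum>n<N. \<psi> n (x i) * cnj (\<psi> n (x j)))))"
    and integral_det_finite_rank_kernel: "(\<integral>x.
      Determinant.det (Matrix.mat k k (\<lambda>(i, j). \<Sum>n<N. \<psi> n (x i) * cnj (\<psi> n (x j))))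
        \<partial>PiM {..<k} (\<lambda>_. M)) = (\<Sum>g\<in>inj_tuples k {..<N}. \<Prod>i<k. l (g i))"
proof -
  interpret P: product_sigma_finite "\<lambda>_ :: nat. M" by unfold_locales
  have int_prod: "integrable (PiM {..<k} (\<lambda>_. M))
      (\<lambda>x. \<Prod>i<k. \<psi> (g i) (x i) * cnj (\<psi> (g (inv_into UNIV p i)) (x i)))" for g p
    by (rule P.product_integrable_prod) (auto intro: int)
  show "integrable (PiM {..<k} (\<lambda>_. M)) (\<lambda>x.
      Determinant.det (Matrix.mat k k (\<lambda>(i, j). \<Sum>n<N. \<psi> n (x i) * cnj (\<psi> n (x j)))))"
    unfolding det_finite_rank_kernel
    by (intro Bochner_Integration.integrable_sum integrable_mult_right int_prod)
  have "(\<integral>x. Determinant.det (Matrix.mat k k (\<lambda>(i, j). \<Sum>n<N. \<psi> n (x i) * cnj (\<psi> n (x j))))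
        \<partial>PiM {..<k} (\<lambda>_. M)) =
      (\<Sum>g\<in>{..<k} \<rightarrow>\<^sub>E {..<N}. \<Sum>p | p permutes {..<k}. signof p *
        (\<integral>x. (\<Prod>i<k. \<psi> (g i) (x i) * cnj (\<psi> (g (inv_into UNIV p i)) (x i))) \<partial>PiM {..<k} (\<lambda>_. M)))"
    unfolding det_finite_rank_kernel
    by (subst Bochner_Integration.integral_sum,
        intro Bochner_Integration.integrable_sum integrable_mult_right int_prod)
       (subst Bochner_Integration.integral_sum,
        intro integrable_mult_right int_prod, simp)
  also have "\<dots> = (\<Sum>g\<in>{..<k} \<rightarrow>\<^sub>E {..<N}. \<Sum>p | p permutes {..<k}. signof p *
        (\<Prod>i<k. of_bool (g i = g (inv_into UNIV p i)) * l (g i)))"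
    by (intro sum.cong refl arg_cong2[where f="(*)"], subst P.product_integral_prod)
       (auto simp: orth int)
  also have "\<dots> = (\<Sum>g\<in>{..<k} \<rightarrow>\<^sub>E {..<N}. (\<Prod>i<k. l (g i)) *
      (\<Sum>p | p permutes {..<k}. signof p * (\<Prod>i<k. of_bool (g i = g (inv_into UNIV p i)))))"
    by (simp add: prod.distrib sum_distrib_left mult_ac)
  also have "\<dots> = (\<Sum>g\<in>{..<k} \<rightarrow>\<^sub>E {..<N}. (\<Prod>i<k. l (g i)) * of_bool (inj_on g {..<k}))"
    unfolding sum_signof_stabilizer ..
  also have "\<dots> = (\<Sum>g\<in>inj_tuples k {..<N}. \<Prod>i<k. l (g i))"
    unfolding inj_tuples_def
    by (rule sum.mono_neutral_cong_right) (auto intro: finite_PiE)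
  finally show "(\<integral>x.
      Determinant.det (Matrix.mat k k (\<lambda>(i, j). \<Sum>n<N. \<psi> n (x i) * cnj (\<psi> n (x j))))
        \<partial>PiM {..<k} (\<lambda>_. M)) = (\<Sum>g\<in>inj_tuples k {..<N}. \<Prod>i<k. l (g i))" .
qed

text \<open>
  Passage from finite rank to a kernel given by an infinite orthogonal expansion, by dominated
  convergence. The functions are supported in a set \<open>D\<close> of finite measure, on which the expansion
  is uniformly summable, so that the determinants have a bounded majorant supported in \<open>D ^ k\<close>.
\<close>
lemma (in sigma_finite_measure)
  fixes \<psi> :: "nat \<Rightarrow> 'a \<Rightarrow> complex" and k :: nat
  assumes meas [measurable]: "\<And>n. \<psi> n \<in> borel_measurable M"
    and D: "D \<in> sets M" "emeasure M D < \<infinity>"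
    and bound: "\<And>n x. norm (\<psi> n x) \<le> s n * indicator D x"
    and summable: "summable (\<lambda>n. s n ^ 2)"
    and orth: "\<And>m n. (\<integral>x. \<psi> m x * cnj (\<psi> n x) \<partial>M) = of_bool (m = n) * l m"
  defines "d \<equiv> \<lambda>x. Determinant.det (Matrix.mat k k (\<lambda>(i, j). \<Sum>n. \<psi> n (x i) * cnj (\<psi> n (x j))))"
  shows integrable_det_kernel: "integrable (PiM {..<k} (\<lambda>_. M)) d"
    and LIMSEQ_integral_det_kernel:
      "(\<lambda>N. \<Sum>g\<in>inj_tuples k {..<N}. \<Prod>i<k. l (g i)) \<longlonglongrightarrow> integral\<^sup>L (PiM {..<k} (\<lambda>_. M)) d"
proof -
  interpret P: product_sigma_finite "\<lambda>_ :: nat. M" by unfold_locales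
  define dN where "dN N x = Determinant.det (Matrix.mat k k
    (\<lambda>(i, j). \<Sum>n<N. \<psi> n (x i) * cnj (\<psi> n (x j))))" for N x
  have cnj_meas [measurable]: "cnj \<in> borel_measurable borel"
    by (intro borel_measurable_continuous_onI continuous_intros)
  define C where "C = (\<Sum>n. s n ^ 2)"
  define w where "w x = (\<Sum>p | p permutes {..<k}. \<Prod>i<k. C * indicator D (x i) :: real)" for x :: "nat \<Rightarrow> 'a"
  have term_bound: "norm (\<psi> m x * cnj (\<psi> n y)) \<le> s m * s n * indicator D x" for m n x y
  proof -
    have "norm (\<psi> m x * cnj (\<psi> n y)) \<le> (s m * indicator D x) * (s n * indicator D y)"
      unfolding norm_mult complex_mod_cnj
      by (rule mult_mono[OF bound bound]) (use norm_ge_zero order_trans bound in blast)+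
    also have "\<dots> \<le> s m * s n * indicator D x"
    proof (cases "x \<in> D \<and> y \<notin> D")
      case True
      have "0 \<le> s m" using order_trans[OF norm_ge_zero bound, of m x] True by simp
      moreover have "0 \<le> s n" using order_trans[OF norm_ge_zero bound, of n x] True by simp
      ultimately show ?thesis using True by simp
    qed (auto simp: indicator_def)
    finally show ?thesis .
  qed
  have term_bound': "norm (\<psi> n x * cnj (\<psi> n y)) \<le> (s n)\<^sup>2 * indicator D x" for n x y
    using term_bound[of n x n y] by (simp add: power2_eq_square)
  have int: "integrable M (\<lambda>x. \<psi> m x * cnj (\<psi> n x))" for m n
  proof (rule integrableI_bounded_set[OF D(1) _ D(2)])
    show "AE x in M. x \<in> D \<longrightarrow> norm (\<psi> m x * cnj (\<psi> n x)) \<le> s m * s n"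
      using term_bound[of m _ n] by (metis (mono_tags, lifting) AE_I2 indicator_simps(1) mult_cancel_left2)
    show "AE x in M. x \<notin> D \<longrightarrow> \<psi> m x * cnj (\<psi> n x) = 0"
      using term_bound[of m _ n] by (intro AE_I2) (metis indicator_simps(2) mult_zero_right norm_le_zero_iff)
  qed simp
  have summ: "summable (\<lambda>n. \<psi> n x * cnj (\<psi> n y))" for x y
    by (rule summable_comparison_test'[OF summable_mult2[OF summable, of "indicator D x"], of 0])
       (rule term_bound')
  \<comment> \<open>The bound keeps the indicator of the first variable only; the product over all rows is then supported in \<open>D ^ k\<close>.\<close>
  have part_bound: "norm (\<Sum>n<N. \<psi> n x * cnj (\<psi> n y)) \<le> C * indicator D x" for N x y
  proof -
    have "norm (\<Sum>n<N. \<psi> n x * cnj (\<psi> n y)) \<le> (\<Sum>n<N. (s n)\<^sup>2 * indicator D x)"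
      by (rule sum_norm_le) (rule term_bound')
    also have "\<dots> = (\<Sum>n<N. (s n)\<^sup>2) * indicator D x" by (simp add: sum_distrib_right)
    also have "\<dots> \<le> C * indicator D x"
      unfolding C_def by (intro mult_right_mono sum_le_suminf summable) auto
    finally show ?thesis .
  qed
  have dN_eq: "dN N x = (\<Sum>p | p permutes {..<k}. signof p *
      (\<Prod>i<k. \<Sum>n<N. \<psi> n (x i) * cnj (\<psi> n (x (p i)))))" for N x
    unfolding dN_def by (subst det_def'[of _ k])
       (auto simp: atLeast0LessThan intro!: sum.cong prod.cong
             dest: permutes_in_image[of _ "{..<k}"])
  have d_eq: "d x = (\<Sum>p | p permutes {..<k}. signof p *
      (\<Prod>i<k. \<Sum>n. \<psi> n (x i) * cnj (\<psi> n (x (p i)))))" for x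
    unfolding d_def by (subst det_def'[of _ k])
       (auto simp: atLeast0LessThan intro!: sum.cong prod.cong
             dest: permutes_in_image[of _ "{..<k}"])
  have lim: "(\<lambda>N. dN N x) \<longlonglongrightarrow> d x" for x
    unfolding dN_eq d_eq by (intro tendsto_intros summable_LIMSEQ summ)
  have "norm (dN N x) \<le> w x" for N x
    unfolding dN_eq w_def
  proof (rule sum_norm_le)
    fix p assume "p \<in> {p. p permutes {..<k}}"
    have "norm (signof p * (\<Prod>i<k. \<Sum>n<N. \<psi> n (x i) * cnj (\<psi> n (x (p i))))) =
        (\<Prod>i<k. norm (\<Sum>n<N. \<psi> n (x i) * cnj (\<psi> n (x (p i)))))"
      by (simp add: norm_mult sign_def prod_norm)
    also have "\<dots> \<le> (\<Prod>i<k. C * indicator D (x i))"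
      by (intro prod_mono conjI norm_ge_zero part_bound)
    finally show "norm (signof p * (\<Prod>i<k. \<Sum>n<N. \<psi> n (x i) * cnj (\<psi> n (x (p i))))) \<le>
        (\<Prod>i<k. C * indicator D (x i))" .
  qed
  then have dom: "AE x in PiM {..<k} (\<lambda>_. M). norm (dN N x) \<le> w x" for N by simp
  have w: "integrable (PiM {..<k} (\<lambda>_. M)) w"
    unfolding w_def using D
    by (intro Bochner_Integration.integrable_sum P.product_integrable_prod)
       (auto intro: integrable_real_mult_indicator)
  have dN_int: "integrable (PiM {..<k} (\<lambda>_. M)) (dN N)" for N
    unfolding dN_def by (rule integrable_det_finite_rank_kernel[OF int orth])
  have dN_meas: "dN N \<in> borel_measurable (PiM {..<k} (\<lambda>_. M))" for N
    using dN_int by (rule borel_measurable_integrable)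
  have d_meas: "d \<in> borel_measurable (PiM {..<k} (\<lambda>_. M))"
    by (rule borel_measurable_LIMSEQ_metric[OF dN_meas]) (rule lim)
  show "integrable (PiM {..<k} (\<lambda>_. M)) d"
    by (rule integrable_dominated_convergence[OF d_meas dN_meas w AE_I2[OF lim] dom])
  have "(\<lambda>N. integral\<^sup>L (PiM {..<k} (\<lambda>_. M)) (dN N)) \<longlonglongrightarrow> integral\<^sup>L (PiM {..<k} (\<lambda>_. M)) d"
    by (rule integral_dominated_convergence[OF d_meas dN_meas w AE_I2[OF lim] dom])
  then show "(\<lambda>N. \<Sum>g\<in>inj_tuples k {..<N}. \<Prod>i<k. l (g i)) \<longlonglongrightarrow> integral\<^sup>L (PiM {..<k} (\<lambda>_. M)) d"
    unfolding dN_def integral_det_finite_rank_kernel[OF int orth] .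
qed

lemma det_restricted_kernel:
  fixes K :: "'a \<Rightarrow> 'a \<Rightarrow> complex" and k :: nat
  shows "Determinant.det (Matrix.mat k k (\<lambda>(i, j). indicator D (x i) * indicator D (x j) * K (x i) (x j))) =
    (if \<forall>i<k. x i \<in> D then Determinant.det (Matrix.mat k k (\<lambda>(i, j). K (x i) (x j))) else 0)"
proof (cases "\<forall>i<k. x i \<in> D")
  case True
  then have "Matrix.mat k k (\<lambda>(i, j). indicator D (x i) * indicator D (x j) * K (x i) (x j)) =
      Matrix.mat k k (\<lambda>(i, j). K (x i) (x j))"
    by (intro eq_matI) auto
  then show ?thesis using True by simp
next
  case False
  then obtain i where i: "i < k" "x i \<notin> D" by auto
  have "(\<Prod>i = 0..<k. Matrix.mat k k (\<lambda>(i, j). indicator D (x i) * indicator D (x j) * K (x i) (x j)) $$ (i, p i)) = 0"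
    if "p permutes {0..<k}" for p
    using i permutes_in_image[OF that, of i] by (intro prod_zero) (auto intro!: bexI[of _ i])
  then have "Determinant.det (Matrix.mat k k (\<lambda>(i, j). indicator D (x i) * indicator D (x j) * K (x i) (x j))) = 0"
    by (subst det_def'[of _ k]) (auto intro!: sum.neutral)
  then show ?thesis unfolding if_not_P[OF False] .
qed

section \<open>Factorial moments from joint intensities\<close>

text \<open>
  The tuples of elements of \<open>S\<close> whose coordinates lie in pairwise distinct cells of the partition
  given by \<open>h\<close>.
\<close>
definition separated_tuples :: "('a \<Rightarrow> 'c) \<Rightarrow> nat \<Rightarrow> 'a set \<Rightarrow> (nat \<Rightarrow> 'a) set" where
  "separated_tuples h k S = {x \<in> {..<k} \<rightarrow>\<^sub>E S. inj_on (\<lambda>i. h (x i)) {..<k}}"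

lemma UN_separated_tuples:
  assumes "refining_cells c"
  shows "(\<Union>m. separated_tuples (c m) k S) = inj_tuples k S"
proof (intro equalityI subsetI)
  fix x assume "x \<in> inj_tuples k S"
  then have x: "x \<in> {..<k} \<rightarrow>\<^sub>E S" "inj_on x {..<k}" by (auto simp: inj_tuples_def)
  obtain m where "inj_on (\<lambda>i. c m (x i)) {..<k}"
    using refining_cells_separate[OF assms _ x(2)] by auto
  then show "x \<in> (\<Union>m. separated_tuples (c m) k S)"
    using x(1) by (auto simp: separated_tuples_def)
next
  fix x assume "x \<in> (\<Union>m. separated_tuples (c m) k S)"
  then obtain m where x: "x \<in> {..<k} \<rightarrow>\<^sub>E S" "inj_on (\<lambda>i. c m (x i)) {..<k}"
    by (auto simp: separated_tuples_def)
  have "inj_on x {..<k}" using x(2) unfolding inj_on_def by metis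
  then show "x \<in> inj_tuples k S" using x(1) by (simp add: inj_tuples_def)
qed

lemma incseq_separated_tuples:
  assumes "refining_cells c"
  shows "incseq (\<lambda>m. separated_tuples (c m) k S)"
proof (rule monoI)
  fix m n :: nat assume "m \<le> n"
  then show "separated_tuples (c m) k S \<subseteq> separated_tuples (c n) k S"
    using refining_cells_inj_on_mono[OF assms] unfolding separated_tuples_def by blast
qed

text \<open>
  The tuples in distinct cells form a disjoint union of boxes whose sides are pairwise disjoint.
  On such boxes the joint intensities are tested.
\<close>
lemma separated_tuples_eq_UN_boxes:
  assumes "S \<subseteq> D"
  shows "separated_tuples h k S = (\<Union>j\<in>inj_tuples k (h ` D). \<Pi>\<^sub>E i\<in>{..<k}. S \<inter> h -` {j i})"
proof (intro equalityI subsetI)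
  fix x assume "x \<in> separated_tuples h k S"
  then have x: "x \<in> {..<k} \<rightarrow>\<^sub>E S" "inj_on (\<lambda>i. h (x i)) {..<k}"
    by (auto simp: separated_tuples_def)
  let ?j = "\<lambda>i\<in>{..<k}. h (x i)"
  have "inj_on ?j {..<k}" using x(2) by (simp add: inj_on_def)
  moreover have "?j \<in> {..<k} \<rightarrow>\<^sub>E h ` D"
    by (intro PiE_I) (use x(1) assms in \<open>auto simp: PiE_def Pi_def\<close>)
  moreover have "x \<in> (\<Pi>\<^sub>E i\<in>{..<k}. S \<inter> h -` {?j i})"
    using x(1) by (auto simp: PiE_iff)
  ultimately show "x \<in> (\<Union>j\<in>inj_tuples k (h ` D). \<Pi>\<^sub>E i\<in>{..<k}. S \<inter> h -` {j i})"
    unfolding inj_tuples_def by blast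
next
  fix x assume "x \<in> (\<Union>j\<in>inj_tuples k (h ` D). \<Pi>\<^sub>E i\<in>{..<k}. S \<inter> h -` {j i})"
  then obtain j where "inj_on j {..<k}" "x \<in> (\<Pi>\<^sub>E i\<in>{..<k}. S \<inter> h -` {j i})"
    by (auto simp: inj_tuples_def)
  then show "x \<in> separated_tuples h k S"
    by (auto simp: separated_tuples_def PiE_iff inj_on_def)
qed

lemma disjoint_family_on_boxes:
  "disjoint_family_on (\<lambda>j. \<Pi>\<^sub>E i\<in>{..<k}. S \<inter> h -` {j i}) (inj_tuples k A)"
proof (unfold disjoint_family_on_def, intro ballI impI)
  fix j j' assume j: "j \<in> inj_tuples k A" "j' \<in> inj_tuples k A" "j \<noteq> j'"
  then have "j \<in> extensional {..<k}" "j' \<in> extensional {..<k}"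
    by (auto simp: inj_tuples_def PiE_def)
  then obtain i where "i < k" "j i \<noteq> j' i"
    using j(3) extensionalityI[of j "{..<k}" j'] by auto
  show "(\<Pi>\<^sub>E i\<in>{..<k}. S \<inter> h -` {j i}) \<inter> (\<Pi>\<^sub>E i\<in>{..<k}. S \<inter> h -` {j' i}) = {}"
  proof (rule equals0I, elim IntE)
    fix x assume "x \<in> (\<Pi>\<^sub>E i\<in>{..<k}. S \<inter> h -` {j i})" "x \<in> (\<Pi>\<^sub>E i\<in>{..<k}. S \<inter> h -` {j' i})"
    from this[THEN PiE_mem, of i] show False
      using \<open>i < k\<close> \<open>j i \<noteq> j' i\<close> by simp
  qed
qed

lemma emeasure_separated_tuples:
  assumes "finite S" "S \<subseteq> D" "finite (h ` D)"
  shows "emeasure (count_space UNIV) (separated_tuples h k S) =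
    (\<Sum>j\<in>inj_tuples k (h ` D). \<Prod>i<k. emeasure (count_space UNIV) (S \<inter> h -` {j i}))"
proof -
  have "card (separated_tuples h k S) =
      (\<Sum>j\<in>inj_tuples k (h ` D). card (\<Pi>\<^sub>E i\<in>{..<k}. S \<inter> h -` {j i}))"
    unfolding separated_tuples_eq_UN_boxes[OF assms(2)]
    using disjoint_family_on_boxes[of k S h "h ` D"] assms
    by (intro card_UN_disjoint) (auto simp: disjoint_family_on_def intro!: finite_PiE)
  also have "\<dots> = (\<Sum>j\<in>inj_tuples k (h ` D). \<Prod>i<k. card (S \<inter> h -` {j i}))"
    by (simp add: card_PiE)
  finally have "card (separated_tuples h k S) = \<dots>" .
  moreover have "finite (separated_tuples h k S)"
    using assms(1) unfolding separated_tuples_def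
    by (intro finite_subset[OF _ finite_PiE[of "{..<k}" "\<lambda>_. S"]]) auto
  ultimately show ?thesis
    using assms(1) by simp
qed

text \<open>
  The \<open>k\<close>-th factorial moment of the number of points in \<open>D\<close> is the integral of the \<open>k\<close>-point
  intensity over \<open>D ^ k\<close>. For tuples in distinct cells of a partition this is the definition
  of the intensity, summed over boxes. Refining the partition exhausts all tuples of distinct
  points on one side and the complement of the diagonals in \<open>D ^ k\<close> on the other, and the intensity
  vanishes on the diagonals.
\<close>
lemma
  fixes X :: "'w \<Rightarrow> 'a::topological_space set" and c :: "nat \<Rightarrow> 'a \<Rightarrow> 'c"
  assumes X: "X \<in> M \<rightarrow>\<^sub>M config_space" and \<rho>: "joint_intensities M \<mu> X \<rho>"
    and sets_\<mu>: "sets \<mu> = sets borel"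
    and c: "refining_cells c" and c_meas: "\<And>m j. c m -` {j} \<in> sets borel"
    and D: "D \<in> sets borel" and finite_cells: "\<And>m. finite (c m ` D)"
    and finite_X: "\<And>\<omega>. \<omega> \<in> space M \<Longrightarrow> finite (X \<omega> \<inter> D)"
    and k: "1 \<le> k"
  shows measurable_count_inj_tuples:
      "(\<lambda>\<omega>. emeasure (count_space UNIV) (inj_tuples k (X \<omega> \<inter> D))) \<in> borel_measurable M"
    and factorial_moment_eq_integral:
      "(\<integral>\<^sup>+\<omega>. emeasure (count_space UNIV) (inj_tuples k (X \<omega> \<inter> D)) \<partial>M) =
       (\<integral>\<^sup>+x\<in>PiE {..<k} (\<lambda>_. D). ennreal (\<rho> k x) \<partial>PiM {..<k} (\<lambda>_. \<mu>))"
proof -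
  let ?P = "PiM {..<k} (\<lambda>_. \<mu>)"
  define F where "F m \<omega> = emeasure (count_space UNIV) (separated_tuples (c m) k (X \<omega> \<inter> D))" for m \<omega>
  define B where "B m j = D \<inter> c m -` {j}" for m j
  have \<rho>_meas [measurable]: "\<rho> k \<in> borel_measurable ?P"
    and \<rho>_diag: "\<And>x. x \<in> space ?P \<Longrightarrow> \<not> inj_on x {..<k} \<Longrightarrow> \<rho> k x = 0"
    and \<rho>_int: "\<And>E. (\<forall>i<k. E i \<in> sets borel) \<Longrightarrow> disjoint_family_on E {..<k} \<Longrightarrow>
      (\<integral>\<^sup>+\<omega>. (\<Prod>i<k. emeasure (count_space UNIV) (X \<omega> \<inter> E i)) \<partial>M) =
      (\<integral>\<^sup>+x\<in>PiE {..<k} E. ennreal (\<rho> k x) \<partial>?P)"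
    using \<rho> k unfolding joint_intensities_def by blast+
  have B_meas: "B m j \<in> sets borel" for m j
    unfolding B_def using D c_meas by simp
  have cnt_meas [measurable]: "(\<lambda>\<omega>. emeasure (count_space UNIV) (X \<omega> \<inter> B m j)) \<in> borel_measurable M" for m j
    by (rule measurable_compose[OF X measurable_config_space_count[OF B_meas]])
  have F_eq: "F m \<omega> = (\<Sum>j\<in>inj_tuples k (c m ` D). \<Prod>i<k. emeasure (count_space UNIV) (X \<omega> \<inter> B m (j i)))"
    if "\<omega> \<in> space M" for m \<omega>
    unfolding F_def B_def using emeasure_separated_tuples[OF finite_X[OF that] _ finite_cells]
    by (simp add: Int_assoc)
  have F_meas [measurable]: "F m \<in> borel_measurable M" for m
    by (subst measurable_cong[OF F_eq]) simp_all
  have count_eq: "emeasure (count_space UNIV) (inj_tuples k (X \<omega> \<inter> D)) = (SUP m. F m \<omega>)" for \<omega>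
    unfolding F_def UN_separated_tuples[OF c, symmetric]
    by (rule SUP_emeasure_incseq[symmetric]) (auto intro: incseq_separated_tuples[OF c])
  show "(\<lambda>\<omega>. emeasure (count_space UNIV) (inj_tuples k (X \<omega> \<inter> D))) \<in> borel_measurable M"
    unfolding count_eq by measurable
  have box_meas: "PiE {..<k} (\<lambda>i. B m (j i)) \<in> sets ?P" for m j
    by (rule sets_PiM_I_finite) (auto simp: sets_\<mu> B_meas)
  have T_eq: "separated_tuples (c m) k D =
      (\<Union>j\<in>inj_tuples k (c m ` D). PiE {..<k} (\<lambda>i. B m (j i)))" for m
    unfolding B_def by (rule separated_tuples_eq_UN_boxes) simp
  have T_meas: "separated_tuples (c m) k D \<in> sets ?P" for m
    unfolding T_eq by (intro sets.finite_UN finite_inj_tuples finite_cells box_meas)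
  have F_int: "(\<integral>\<^sup>+\<omega>. F m \<omega> \<partial>M) = emeasure (density ?P (\<rho> k)) (separated_tuples (c m) k D)" for m
  proof -
    have "(\<integral>\<^sup>+\<omega>. F m \<omega> \<partial>M) = (\<integral>\<^sup>+\<omega>. (\<Sum>j\<in>inj_tuples k (c m ` D).
        \<Prod>i<k. emeasure (count_space UNIV) (X \<omega> \<inter> B m (j i))) \<partial>M)"
      by (rule nn_integral_cong) (rule F_eq)
    also have "\<dots> = (\<Sum>j\<in>inj_tuples k (c m ` D).
        \<integral>\<^sup>+\<omega>. (\<Prod>i<k. emeasure (count_space UNIV) (X \<omega> \<inter> B m (j i))) \<partial>M)"
      by (rule nn_integral_sum) measurable
    also have "\<dots> = (\<Sum>j\<in>inj_tuples k (c m ` D).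
        emeasure (density ?P (\<rho> k)) (PiE {..<k} (\<lambda>i. B m (j i))))"
    proof (rule sum.cong[OF refl])
      fix j assume "j \<in> inj_tuples k (c m ` D)"
      then have "disjoint_family_on (\<lambda>i. B m (j i)) {..<k}"
        by (auto simp: disjoint_family_on_def inj_tuples_def B_def inj_on_def)
      then show "(\<integral>\<^sup>+\<omega>. (\<Prod>i<k. emeasure (count_space UNIV) (X \<omega> \<inter> B m (j i))) \<partial>M) =
          emeasure (density ?P (\<rho> k)) (PiE {..<k} (\<lambda>i. B m (j i)))"
        by (simp add: \<rho>_int B_meas emeasure_density box_meas)
    qed
    also have "\<dots> = emeasure (density ?P (\<rho> k)) (separated_tuples (c m) k D)"
      unfolding T_eq B_def
      by (rule sum_emeasure)
         (use disjoint_family_on_boxes finite_cells box_meas in \<open>auto simp: B_def\<close>)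
    finally show ?thesis .
  qed
  have "(\<integral>\<^sup>+\<omega>. emeasure (count_space UNIV) (inj_tuples k (X \<omega> \<inter> D)) \<partial>M) = (\<integral>\<^sup>+\<omega>. (SUP m. F m \<omega>) \<partial>M)"
    unfolding count_eq ..
  also have "\<dots> = (SUP m. \<integral>\<^sup>+\<omega>. F m \<omega> \<partial>M)"
  proof (rule nn_integral_monotone_convergence_SUP[OF _ F_meas])
    show "incseq F"
      unfolding F_def
      by (intro monoI le_funI emeasure_mono incseqD[OF incseq_separated_tuples[OF c]]) auto
  qed
  also have "\<dots> = emeasure (density ?P (\<rho> k)) (\<Union>m. separated_tuples (c m) k D)"
    unfolding F_int
    by (rule SUP_emeasure_incseq) (use T_meas in \<open>auto intro: incseq_separated_tuples[OF c]\<close>)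
  also have "\<dots> = (\<integral>\<^sup>+x\<in>(\<Union>m. separated_tuples (c m) k D). ennreal (\<rho> k x) \<partial>?P)"
    by (rule emeasure_density) (use T_meas in auto)
  also have "\<dots> = (\<integral>\<^sup>+x\<in>PiE {..<k} (\<lambda>_. D). ennreal (\<rho> k x) \<partial>?P)"
    unfolding UN_separated_tuples[OF c] inj_tuples_def
    by (rule nn_integral_cong) (auto simp: indicator_def \<rho>_diag)
  finally show "(\<integral>\<^sup>+\<omega>. emeasure (count_space UNIV) (inj_tuples k (X \<omega> \<inter> D)) \<partial>M) =
      (\<integral>\<^sup>+x\<in>PiE {..<k} (\<lambda>_. D). ennreal (\<rho> k x) \<partial>?P)" .
qed

section \<open>Factorial moments from independent events\<close>

lemma inj_tuples_eq_UN_lessThan: "inj_tuples k S = (\<Union>N. inj_tuples k (S \<inter> {..<N}))" for S :: "nat set"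
proof (intro equalityI subsetI)
  fix x assume "x \<in> inj_tuples k S"
  then have x: "x \<in> {..<k} \<rightarrow>\<^sub>E S" "inj_on x {..<k}" by (auto simp: inj_tuples_def)
  obtain N where N: "\<And>i. i < k \<Longrightarrow> x i < N"
    using finite_nat_set_iff_bounded[of "x ` {..<k}"] by auto
  then have "x \<in> {..<k} \<rightarrow>\<^sub>E S \<inter> {..<N}" using x(1) by (auto simp: PiE_iff)
  then show "x \<in> (\<Union>N. inj_tuples k (S \<inter> {..<N}))"
    using x(2) unfolding inj_tuples_def by blast
qed (auto simp: inj_tuples_def PiE_iff)

text \<open>
  The limit \<open>F k\<close> is at most the \<open>k\<close>-th power of the total sum \<open>F 1\<close> of \<open>l\<close>, so that
  \<open>F k / fact k\<close> is dominated by the exponential series.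
\<close>
lemma sum_prod_inj_tuples:
  fixes l :: "nat \<Rightarrow> real"
  assumes nonneg: "\<And>n. 0 \<le> l n"
    and lim: "\<And>k. (\<lambda>N. \<Sum>g\<in>inj_tuples k {..<N}. \<Prod>i<k. l (g i)) \<longlonglongrightarrow> F k"
  shows sum_prod_inj_tuples_nonneg: "0 \<le> F k"
    and sum_prod_inj_tuples_summable: "summable (\<lambda>k. F k / fact k)"
    and sum_prod_inj_tuples_0: "F 0 = 1"
proof -
  have F_nonneg: "0 \<le> F k" for k
    by (rule LIMSEQ_le_const[OF lim]) (auto intro!: sum_nonneg prod_nonneg nonneg)
  then show "0 \<le> F k" .
  have pow: "(\<Sum>g\<in>{..<k} \<rightarrow>\<^sub>E {..<N}. \<Prod>i<k. l (g i)) = (\<Sum>n<N. l n) ^ k" for k N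
    using prod_sum_PiE[of "{..<k}" "\<lambda>_. {..<N}" "\<lambda>_. l"] by simp
  have one: "(\<Sum>g\<in>inj_tuples 1 {..<N}. \<Prod>i<1. l (g i)) = (\<Sum>n<N. l n)" for N
  proof -
    have "inj_tuples 1 {..<N} = {..<1} \<rightarrow>\<^sub>E {..<N}"
      by (auto simp: inj_tuples_def inj_on_def)
    then show ?thesis using pow[of 1 N] by simp
  qed
  have le: "(\<Sum>n<N. l n) \<le> F 1" for N
  proof (rule incseq_le)
    show "incseq (\<lambda>N. \<Sum>n<N. l n)"
      by (intro monoI sum_mono2) (auto intro: nonneg)
    show "(\<lambda>N. \<Sum>n<N. l n) \<longlonglongrightarrow> F 1" using lim[of 1] unfolding one .
  qed
  have bound: "F k \<le> F 1 ^ k" for k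
  proof (rule LIMSEQ_le_const2[OF lim], intro exI allI impI)
    fix N
    have "(\<Sum>g\<in>inj_tuples k {..<N}. \<Prod>i<k. l (g i)) \<le> (\<Sum>g\<in>{..<k} \<rightarrow>\<^sub>E {..<N}. \<Prod>i<k. l (g i))"
      by (rule sum_mono2) (auto simp: inj_tuples_def intro!: finite_PiE prod_nonneg nonneg)
    also have "\<dots> \<le> F 1 ^ k"
      unfolding pow by (intro power_mono le sum_nonneg nonneg)
    finally show "(\<Sum>g\<in>inj_tuples k {..<N}. \<Prod>i<k. l (g i)) \<le> F 1 ^ k" .
  qed
  show "summable (\<lambda>k. F k / fact k)"
  proof (rule summable_comparison_test'[OF summable_exp[of "F 1"], of 0])
    fix k :: nat
    show "norm (F k / fact k) \<le> inverse (fact k) * F 1 ^ k"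
      using bound[of k] F_nonneg[of k] by (simp add: divide_inverse mult.commute)
  qed
  have "(\<lambda>N. \<Sum>g\<in>inj_tuples 0 {..<N}. \<Prod>i<0. l (g i)) = (\<lambda>N. 1)"
    by (simp add: card_inj_tuples)
  then show "F 0 = 1" using lim[of 0] by (simp add: LIMSEQ_const_iff)
qed

lemma (in prob_space)
  fixes A :: "nat \<Rightarrow> 'a set"
  assumes indep: "indep_events A UNIV"
    and lim: "(\<lambda>N. \<Sum>g\<in>inj_tuples k {..<N}. \<Prod>i<k. prob (A (g i))) \<longlonglongrightarrow> F"
  shows measurable_count_indep_events:
      "(\<lambda>\<omega>. emeasure (count_space UNIV) (inj_tuples k {n. \<omega> \<in> A n})) \<in> borel_measurable M"
    and factorial_moment_indep_events:
      "(\<integral>\<^sup>+\<omega>. emeasure (count_space UNIV) (inj_tuples k {n. \<omega> \<in> A n}) \<partial>M) = ennreal F"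
proof -
  have A [measurable]: "A n \<in> events" for n using indep by (auto simp: indep_events_def)
  have indep_prod: "prob (\<Inter>j\<in>J. A j) = (\<Prod>j\<in>J. prob (A j))" if "J \<noteq> {}" "finite J" for J
    using indep[unfolded indep_events_def, THEN conjunct2, rule_format, OF subset_UNIV that] .
  let ?E = "\<lambda>g. {\<omega>\<in>space M. \<forall>i<k. \<omega> \<in> A (g i)}"
  define G where "G N \<omega> = emeasure (count_space UNIV) (inj_tuples k ({n. \<omega> \<in> A n} \<inter> {..<N}))" for N \<omega>
  have E_meas [measurable]: "?E g \<in> events" for g by measurable
  have E_prob: "emeasure M (?E g) = ennreal (\<Prod>i<k. prob (A (g i)))" if "g \<in> inj_tuples k S" for g S
  proof (cases "k = 0")
    case False
    have inj: "inj_on g {..<k}" using that by (simp add: inj_tuples_def)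
    have "?E g = (\<Inter>j\<in>g ` {..<k}. A j)"
      using False sets.sets_into_space[OF A] by auto
    moreover have "prob (\<Inter>j\<in>g ` {..<k}. A j) = (\<Prod>j\<in>g ` {..<k}. prob (A j))"
      using False by (intro indep_prod) auto
    ultimately show ?thesis
      by (simp add: emeasure_eq_measure prod.reindex[OF inj])
  qed (simp add: emeasure_space_1)
  have G_eq: "G N \<omega> = (\<Sum>g\<in>inj_tuples k {..<N}. indicator (?E g) \<omega>)" if "\<omega> \<in> space M" for N \<omega>
  proof -
    have "inj_tuples k ({n. \<omega> \<in> A n} \<inter> {..<N}) = {g \<in> inj_tuples k {..<N}. \<omega> \<in> ?E g}"
      using that by (auto simp: inj_tuples_def PiE_iff)
    moreover have "(\<Sum>g\<in>inj_tuples k {..<N}. indicator (?E g) \<omega> :: ennreal) =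
        of_nat (card {g \<in> inj_tuples k {..<N}. \<omega> \<in> ?E g})"
      by (subst sum.mono_neutral_right[of _ "{g \<in> inj_tuples k {..<N}. \<omega> \<in> ?E g}"]) auto
    ultimately show ?thesis by (simp add: G_def)
  qed
  have G_meas [measurable]: "G N \<in> borel_measurable M" for N
    by (subst measurable_cong[OF G_eq]) simp_all
  have count_eq: "emeasure (count_space UNIV) (inj_tuples k {n. \<omega> \<in> A n}) = (SUP N. G N \<omega>)" for \<omega>
    unfolding G_def inj_tuples_eq_UN_lessThan[of k "{n. \<omega> \<in> A n}"]
    by (rule SUP_emeasure_incseq[symmetric]) (auto intro!: monoI inj_tuples_mono)
  have G_mono: "incseq G"
    unfolding G_def by (intro monoI le_funI emeasure_mono inj_tuples_mono) auto
  show "(\<lambda>\<omega>. emeasure (count_space UNIV) (inj_tuples k {n. \<omega> \<in> A n})) \<in> borel_measurable M"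
    unfolding count_eq by measurable
  have G_int: "(\<integral>\<^sup>+\<omega>. G N \<omega> \<partial>M) = ennreal (\<Sum>g\<in>inj_tuples k {..<N}. \<Prod>i<k. prob (A (g i)))" for N
  proof -
    have "(\<integral>\<^sup>+\<omega>. G N \<omega> \<partial>M) = (\<integral>\<^sup>+\<omega>. (\<Sum>g\<in>inj_tuples k {..<N}. indicator (?E g) \<omega>) \<partial>M)"
      by (rule nn_integral_cong) (rule G_eq)
    also have "\<dots> = (\<Sum>g\<in>inj_tuples k {..<N}. emeasure M (?E g))"
      by (subst nn_integral_sum) simp_all
    also have "\<dots> = (\<Sum>g\<in>inj_tuples k {..<N}. ennreal (\<Prod>i<k. prob (A (g i))))"
      by (rule sum.cong[OF refl]) (rule E_prob)
    also have "\<dots> = ennreal (\<Sum>g\<in>inj_tuples k {..<N}. \<Prod>i<k. prob (A (g i)))"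
      by (rule sum_ennreal) (auto intro: prod_nonneg)
    finally show ?thesis .
  qed
  have "(\<integral>\<^sup>+\<omega>. emeasure (count_space UNIV) (inj_tuples k {n. \<omega> \<in> A n}) \<partial>M) = (SUP N. \<integral>\<^sup>+\<omega>. G N \<omega> \<partial>M)"
    unfolding count_eq by (rule nn_integral_monotone_convergence_SUP[OF G_mono G_meas])
  also have "\<dots> = ennreal F"
  proof (rule LIMSEQ_unique)
    show "(\<lambda>N. \<integral>\<^sup>+\<omega>. G N \<omega> \<partial>M) \<longlonglongrightarrow> (SUP N. \<integral>\<^sup>+\<omega>. G N \<omega> \<partial>M)"
      using G_mono by (intro LIMSEQ_SUP monoI nn_integral_mono) (auto simp: mono_def le_fun_def)
    show "(\<lambda>N. \<integral>\<^sup>+\<omega>. G N \<omega> \<partial>M) \<longlonglongrightarrow> ennreal F"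
      unfolding G_int by (rule tendsto_ennrealI[OF lim])
  qed
  finally show "(\<integral>\<^sup>+\<omega>. emeasure (count_space UNIV) (inj_tuples k {n. \<omega> \<in> A n}) \<partial>M) = ennreal F" .
qed

section \<open>Growth of the Gamma function\<close>

text \<open>
  The Gamma integral, restricted to \<open>{s..s + 1}\<close>. Since \<open>s\<close> is arbitrary, \<open>Gamma x\<close> grows
  faster than any exponential, which gives the convergence of the Mittag-Leffler series.
\<close>
lemma Gamma_real_ge:
  fixes x s :: real
  assumes x: "1 \<le> x" and s: "0 < s"
  shows "s powr (x - 1) * exp (- (s + 1)) \<le> Gamma x"
proof -
  have "ennreal (s powr (x - 1) * exp (- (s + 1))) =
      (\<integral>\<^sup>+t. ennreal (s powr (x - 1) * exp (- (s + 1))) * indicator {s..s + 1} t \<partial>lborel)"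
    by (subst nn_integral_cmult_indicator) auto
  also have "\<dots> \<le> (\<integral>\<^sup>+t. ennreal (indicator {0..} t * t powr (x - 1) / exp t) \<partial>lborel)"
  proof (rule nn_integral_mono)
    fix t
    have "s powr (x - 1) * exp (- (s + 1)) \<le> t powr (x - 1) / exp t" if "s \<le> t" "t \<le> s + 1"
    proof -
      have "s powr (x - 1) * exp (- (s + 1)) \<le> t powr (x - 1) * exp (- t)"
        using that x s by (intro mult_mono powr_mono2) auto
      then show ?thesis by (simp add: exp_minus divide_inverse)
    qed
    then show "ennreal (s powr (x - 1) * exp (- (s + 1))) * indicator {s..s + 1} t
        \<le> ennreal (indicator {0..} t * t powr (x - 1) / exp t)"
      using s by (auto simp: indicator_def intro!: ennreal_leI)
  qed
  also have "\<dots> = ennreal (Gamma x)"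
    using x by (simp add: Gamma_conv_nn_integral_real)
  finally show ?thesis
    using Gamma_real_pos[of x] x by (subst (asm) ennreal_le_iff) auto
qed

lemma summable_power_div_Gamma:
  fixes a t :: real
  assumes a: "0 < a" and t: "0 \<le> t"
  shows "summable (\<lambda>n. t ^ n / Gamma (a * real n + a))"
proof -
  \<comment> \<open>The base is chosen such that \<open>s powr (a * n)\<close> is \<open>(2 * t + 1) ^ n\<close>, which beats \<open>t ^ n\<close>.\<close>
  define s where "s = (2 * t + 1) powr (1 / a)"
  define C where "C = s powr (a - 1) * exp (- (s + 1))"
  have s: "0 < s" using t by (simp add: s_def)
  then have C: "0 < C" by (simp add: C_def)
  have bound: "C * (2 * t + 1) ^ n \<le> Gamma (a * real n + a)" if "1 \<le> a * real n + a" for n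
  proof -
    have "s powr (a * real n) = (2 * t + 1) ^ n"
      using a t by (simp add: s_def powr_powr powr_realpow)
    moreover have "s powr (a * real n + a - 1) = s powr (a * real n) * s powr (a - 1)"
      by (simp add: powr_add[symmetric] algebra_simps)
    ultimately show ?thesis
      using Gamma_real_ge[OF that s] by (simp add: C_def mult_ac)
  qed
  obtain n0 :: nat where n0: "1 / a \<le> real n0" using real_arch_simple by blast
  show ?thesis
  proof (rule summable_comparison_test')
    show "summable (\<lambda>n. 1 / C * (t / (2 * t + 1)) ^ n)"
      using t by (intro summable_mult summable_geometric) auto
    fix n assume "n0 \<le> n"
    then have "1 / a \<le> real n" using n0 by linarith
    then have "1 \<le> a * real n + a" using a by (simp add: field_simps)
    then have "C * (2 * t + 1) ^ n \<le> Gamma (a * real n + a)" by (rule bound)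
    moreover have "0 < C * (2 * t + 1) ^ n" using C t by simp
    moreover have "0 < Gamma (a * real n + a)"
      using a by (intro Gamma_real_pos) (simp add: add_nonneg_pos)
    moreover from calculation have "t ^ n / Gamma (a * real n + a) \<le> t ^ n / (C * (2 * t + 1) ^ n)"
      using t C by (intro divide_left_mono mult_pos_pos) auto
    ultimately show "norm (t ^ n / Gamma (a * real n + a)) \<le> 1 / C * (t / (2 * t + 1)) ^ n"
      using t by (simp add: power_divide)
  qed
qed

section \<open>Lebesgue measure on the complex plane: rotations and the norm\<close>

lemma lborel_complex_eq:
  "(lborel :: complex measure) = distr (lborel \<Otimes>\<^sub>M lborel) borel (\<lambda>(x, y). Complex x y)"
proof (rule lborel_eqI)
  have [measurable]: "(\<lambda>(x, y). Complex x y) \<in> borel_measurable (lborel \<Otimes>\<^sub>M lborel)"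
    unfolding Complex_eq by measurable
  fix l u :: complex assume le: "\<And>b. b \<in> Basis \<Longrightarrow> l \<bullet> b \<le> u \<bullet> b"
  have "Re l \<le> Re u" "Im l \<le> Im u"
    using le[of 1] le[of \<i>] by (auto simp: Basis_complex_def inner_complex_def)
  moreover have "(\<lambda>(x, y). Complex x y) -` box l u = {Re l<..<Re u} \<times> {Im l<..<Im u}"
    by (auto simp: box_def Basis_complex_def inner_complex_def)
  ultimately show "emeasure (distr (lborel \<Otimes>\<^sub>M lborel) borel (\<lambda>(x, y). Complex x y)) (box l u) =
      (\<Prod>b\<in>Basis. (u - l) \<bullet> b)"
    by (simp add: emeasure_distr space_pair_measure lborel.emeasure_pair_measure_Times
        Basis_complex_def inner_complex_def ennreal_mult)
qed simp

lemma
  fixes f :: "complex \<Rightarrow> ennreal"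
  assumes [measurable]: "f \<in> borel_measurable borel"
  shows nn_integral_lborel_complex: "(\<integral>\<^sup>+z. f z \<partial>lborel) = (\<integral>\<^sup>+y. \<integral>\<^sup>+x. f (Complex x y) \<partial>lborel \<partial>lborel)"
    and nn_integral_lborel_complex': "(\<integral>\<^sup>+z. f z \<partial>lborel) = (\<integral>\<^sup>+x. \<integral>\<^sup>+y. f (Complex x y) \<partial>lborel \<partial>lborel)"
proof -
  have [measurable]: "(\<lambda>(x, y). Complex x y) \<in> borel_measurable (lborel \<Otimes>\<^sub>M lborel)"
    unfolding Complex_eq by measurable
  have "(\<integral>\<^sup>+z. f z \<partial>lborel) = (\<integral>\<^sup>+p. f (case p of (x, y) \<Rightarrow> Complex x y) \<partial>(lborel \<Otimes>\<^sub>M lborel))"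
    by (subst lborel_complex_eq) (rule nn_integral_distr, measurable)
  moreover have meas: "(\<lambda>p. f (case p of (x, y) \<Rightarrow> Complex x y)) \<in> borel_measurable (lborel \<Otimes>\<^sub>M lborel)"
    by measurable
  ultimately show "(\<integral>\<^sup>+z. f z \<partial>lborel) = (\<integral>\<^sup>+y. \<integral>\<^sup>+x. f (Complex x y) \<partial>lborel \<partial>lborel)"
    "(\<integral>\<^sup>+z. f z \<partial>lborel) = (\<integral>\<^sup>+x. \<integral>\<^sup>+y. f (Complex x y) \<partial>lborel \<partial>lborel)"
    using lborel_pair.nn_integral_snd[OF meas] lborel.nn_integral_fst[OF meas] by simp_all
qed

lemma lborel_shear_Re:
  "distr lborel borel (\<lambda>z. Complex (Re z + t * Im z) (Im z)) = lborel"
proof (rule measure_eqI)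
  fix A :: "complex set" assume "A \<in> sets (distr lborel borel (\<lambda>z. Complex (Re z + t * Im z) (Im z)))"
  then have [measurable]: "A \<in> sets borel" by simp
  have [measurable]: "(\<lambda>z. Complex (Re z + t * Im z) (Im z)) \<in> borel_measurable borel"
    unfolding Complex_eq by measurable
  have [measurable]: "(\<lambda>x. Complex x y) \<in> borel_measurable borel" for y
    unfolding Complex_eq by measurable
  have "emeasure (distr lborel borel (\<lambda>z. Complex (Re z + t * Im z) (Im z))) A =
      (\<integral>\<^sup>+z. indicator A (Complex (Re z + t * Im z) (Im z)) \<partial>lborel)"
    by (subst nn_integral_indicator[symmetric], simp, subst nn_integral_distr) simp_all
  also have "\<dots> = (\<integral>\<^sup>+y. \<integral>\<^sup>+x. indicator A (Complex (x + t * y) y) \<partial>lborel \<partial>lborel)"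
    by (subst nn_integral_lborel_complex) simp_all
  also have "\<dots> = (\<integral>\<^sup>+y. \<integral>\<^sup>+x. indicator A (Complex x y) \<partial>lborel \<partial>lborel)"
  proof (rule nn_integral_cong)
    fix y
    show "(\<integral>\<^sup>+x. indicator A (Complex (x + t * y) y) \<partial>lborel) = (\<integral>\<^sup>+x. indicator A (Complex x y) \<partial>lborel)"
      using nn_integral_real_affine[of "\<lambda>x. indicator A (Complex x y)" 1 "t * y"]
      by (simp add: add.commute)
  qed
  also have "\<dots> = emeasure lborel A"
    by (subst nn_integral_lborel_complex[symmetric]) simp_all
  finally show "emeasure (distr lborel borel (\<lambda>z. Complex (Re z + t * Im z) (Im z))) A = emeasure lborel A" .
qed simp

lemma lborel_shear_Im:
  "distr lborel borel (\<lambda>z. Complex (Re z) (Im z + t * Re z)) = lborel"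
proof (rule measure_eqI)
  fix A :: "complex set" assume "A \<in> sets (distr lborel borel (\<lambda>z. Complex (Re z) (Im z + t * Re z)))"
  then have [measurable]: "A \<in> sets borel" by simp
  have [measurable]: "(\<lambda>z. Complex (Re z) (Im z + t * Re z)) \<in> borel_measurable borel"
    unfolding Complex_eq by measurable
  have [measurable]: "(\<lambda>y. Complex x y) \<in> borel_measurable borel" for x
    unfolding Complex_eq by measurable
  have "emeasure (distr lborel borel (\<lambda>z. Complex (Re z) (Im z + t * Re z))) A =
      (\<integral>\<^sup>+z. indicator A (Complex (Re z) (Im z + t * Re z)) \<partial>lborel)"
    by (subst nn_integral_indicator[symmetric], simp, subst nn_integral_distr) simp_all
  also have "\<dots> = (\<integral>\<^sup>+x. \<integral>\<^sup>+y. indicator A (Complex x (y + t * x)) \<partial>lborel \<partial>lborel)"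
    by (subst nn_integral_lborel_complex') simp_all
  also have "\<dots> = (\<integral>\<^sup>+x. \<integral>\<^sup>+y. indicator A (Complex x y) \<partial>lborel \<partial>lborel)"
  proof (rule nn_integral_cong)
    fix x
    show "(\<integral>\<^sup>+y. indicator A (Complex x (y + t * x)) \<partial>lborel) = (\<integral>\<^sup>+y. indicator A (Complex x y) \<partial>lborel)"
      using nn_integral_real_affine[of "\<lambda>y. indicator A (Complex x y)" 1 "t * x"]
      by (simp add: add.commute)
  qed
  also have "\<dots> = emeasure lborel A"
    by (subst nn_integral_lborel_complex'[symmetric]) simp_all
  finally show "emeasure (distr lborel borel (\<lambda>z. Complex (Re z) (Im z + t * Re z))) A = emeasure lborel A" .
qed simp

text \<open>
  A rotation other than the half-turn is a product of three shears, which preserve the Lebesgue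
  measure by Fubini and translation invariance.
\<close>
lemma lborel_rotation:
  fixes u :: complex
  assumes u: "norm u = 1" and Re_u: "Re u \<noteq> - 1"
  shows "distr lborel borel ((*) u) = lborel"
proof -
  \<comment> \<open>The coefficient is minus the tangent of half the angle of \<open>u\<close>.\<close>
  define t where "t = - Im u / (1 + Re u)"
  let ?S = "\<lambda>z. Complex (Re z + t * Im z) (Im z)"
  let ?T = "\<lambda>z. Complex (Re z) (Im z + Im u * Re z)"
  have S: "?S \<in> borel_measurable borel" and T: "?T \<in> borel_measurable borel"
    unfolding Complex_eq by measurable
  have "(Re u)\<^sup>2 + (Im u)\<^sup>2 = 1" using u by (simp add: cmod_def)
  then have "Im u * Im u = (1 - Re u) * (1 + Re u)"
    by (simp add: power2_eq_square algebra_simps)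
  moreover have nz: "1 + Re u \<noteq> 0" using Re_u by auto
  ultimately have c: "1 + t * Im u = Re u"
    by (simp add: t_def field_simps)
  have t: "t * (1 + Re u) = - Im u" using nz by (simp add: t_def)
  have "u * z = ?S (?T (?S z))" for z
  proof (rule complex_eqI)
    have "Im (?S (?T (?S z))) = Im z + Im u * (Re z + t * Im z)" by simp
    also have "\<dots> = (1 + t * Im u) * Im z + Im u * Re z" by (simp add: algebra_simps)
    finally show im: "Im (u * z) = Im (?S (?T (?S z)))" by (simp add: c)
    have "Re (?S (?T (?S z))) = Re z + t * Im z + t * Im (?S (?T (?S z)))" by simp
    also have "\<dots> = Re z + t * Im z + t * (Re u * Im z + Im u * Re z)" unfolding im[symmetric] by simp
    also have "\<dots> = (1 + t * Im u) * Re z + (t * (1 + Re u)) * Im z" by (simp add: algebra_simps)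
    also have "\<dots> = Re (u * z)" unfolding c t by simp
    finally show "Re (u * z) = Re (?S (?T (?S z)))" ..
  qed
  then have "(*) u = ?S \<circ> (?T \<circ> ?S)" by (auto simp: fun_eq_iff)
  then have "distr lborel borel ((*) u) = distr lborel borel (?S \<circ> (?T \<circ> ?S))" by simp
  also have "\<dots> = distr (distr (distr lborel borel ?S) borel ?T) borel ?S"
    using S T by (simp add: distr_distr comp_assoc)
  also have "\<dots> = lborel" by (simp only: lborel_shear_Re lborel_shear_Im)
  finally show ?thesis .
qed

text \<open>
  Polar coordinates for radial functions, obtained from the area of the disc.
\<close>
lemma distr_lborel_norm_complex:
  "distr lborel borel (norm :: complex \<Rightarrow> real) =
    density lborel (\<lambda>r. ennreal (2 * pi * r) * indicator {0..} r)" (is "?L = ?R")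
proof (rule measure_eqI_generator_eq[where \<Omega>=UNIV and E="range atMost" and A="\<lambda>n. {..real n}"])
  show "Int_stable (range (atMost :: real \<Rightarrow> real set))"
    by (auto simp: Int_stable_def)
  show "sets ?L = sigma_sets UNIV (range atMost)" "sets ?R = sigma_sets UNIV (range atMost)"
    by (simp_all add: borel_eq_atMost)
  have eq: "emeasure ?L {..b} = ennreal (if b < 0 then 0 else pi * b\<^sup>2)" for b
  proof -
    have "emeasure ?L {..b} = emeasure lborel (cball (0 :: complex) b)"
      by (subst emeasure_distr) (auto intro!: arg_cong[where f="emeasure lborel"] simp: dist_norm)
    also have "\<dots> = ennreal (if b < 0 then 0 else pi * b\<^sup>2)"
      using unit_ball_vol_2 by (auto simp: emeasure_cball)
    finally show ?thesis .
  qed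
  then show "emeasure ?L {..real n} \<noteq> \<infinity>" for n by simp
  fix X assume "X \<in> range (atMost :: real \<Rightarrow> real set)"
  then obtain b where X: "X = {..b}" by auto
  have "emeasure ?R {..b} = (\<integral>\<^sup>+r. ennreal (2 * pi * r) * indicator {0..} r * indicator {..b} r \<partial>lborel)"
    by (rule emeasure_density) auto
  also have "\<dots> = (\<integral>\<^sup>+r. ennreal (2 * pi * r) * indicator {0..b} r \<partial>lborel)"
    by (rule nn_integral_cong) (auto simp: indicator_def)
  also have "\<dots> = ennreal (if b < 0 then 0 else pi * b\<^sup>2)"
  proof (cases "b < 0")
    case False
    have "(\<integral>\<^sup>+r. ennreal (2 * pi * r) * indicator {0..b} r \<partial>lborel) = ennreal (pi * b\<^sup>2 - pi * 0\<^sup>2)"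
      using False by (intro nn_integral_FTC_Icc) (auto intro!: derivative_eq_intros)
    then show ?thesis using False by simp
  qed simp
  finally show "emeasure ?L X = emeasure ?R X" by (simp add: X eq)
qed (auto simp: real_arch_simple)

section \<open>The law of the radii\<close>

text \<open>
  A measure on the positive half-line is determined by compact subintervals of the open half-line.
  The restriction avoids the singularity of \<open>r powr \<alpha>\<close> at \<open>0\<close> in a substitution.
\<close>
lemma emeasure_eq_SUP_Icc:
  fixes P :: "real measure"
  assumes sets_P [measurable_cong]: "sets P = sets borel" and pos: "AE x in P. 0 < x"
    and B [measurable]: "B \<in> sets borel"
  shows "emeasure P B = (SUP m. emeasure P (B \<inter> {1 / real (Suc m)..real (Suc m)}))"
proof -
  have un: "(\<Union>m. {1 / real (Suc m)..real (Suc m)}) = {0<..}"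
  proof (intro equalityI subsetI)
    fix x :: real assume "x \<in> (\<Union>m. {1 / real (Suc m)..real (Suc m)})"
    then obtain m where "1 / real (Suc m) \<le> x" by auto
    then show "x \<in> {0<..}" using less_le_trans[of 0 "1 / real (Suc m)" x] by simp
  next
    fix x :: real assume "x \<in> {0<..}"
    then have x: "0 < x" by simp
    obtain m :: nat where m: "max x (1 / x) \<le> real m" using real_arch_simple by blast
    then have "1 / x \<le> real (Suc m)" "x \<le> real (Suc m)" by auto
    then have "x \<in> {1 / real (Suc m)..real (Suc m)}" using x by (simp add: field_simps)
    then show "x \<in> (\<Union>m. {1 / real (Suc m)..real (Suc m)})" by blast
  qed
  have "(SUP m. emeasure P (B \<inter> {1 / real (Suc m)..real (Suc m)})) =
      emeasure P (\<Union>m. B \<inter> {1 / real (Suc m)..real (Suc m)})"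
  proof (rule SUP_emeasure_incseq)
    show "incseq (\<lambda>m. B \<inter> {1 / real (Suc m)..real (Suc m)})"
    proof (rule monoI)
      fix m n :: nat assume "m \<le> n"
      then have "1 / real (Suc n) \<le> 1 / real (Suc m)" "real (Suc m) \<le> real (Suc n)"
        by (auto simp: field_simps)
      then show "B \<inter> {1 / real (Suc m)..real (Suc m)} \<subseteq> B \<inter> {1 / real (Suc n)..real (Suc n)}"
        by (auto simp del: of_nat_Suc)
    qed
  qed (auto simp: sets_P)
  also have "(\<Union>m. B \<inter> {1 / real (Suc m)..real (Suc m)}) = B \<inter> {0<..}"
    unfolding un[symmetric] by blast
  also have "emeasure P (B \<inter> {0<..}) = emeasure P B"
    using pos by (intro emeasure_eq_AE) (auto simp: sets_P)
  finally show ?thesis ..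
qed

text \<open>
  The density of the \<open>\<alpha>\<close>-th root of a Gamma distributed variable with parameter
  \<open>2 / \<alpha> * (n + 1)\<close>. The index is shifted by one against that of the radii.
\<close>
definition radial_density :: "real \<Rightarrow> nat \<Rightarrow> real \<Rightarrow> real" where
  "radial_density \<alpha> n r =
    (if r > 0 then \<alpha> * r ^ (2 * n + 1) * exp (- (r powr \<alpha>)) / Gamma (2 / \<alpha> * real n + 2 / \<alpha>) else 0)"

lemma measurable_radial_density [measurable]: "radial_density \<alpha> n \<in> borel_measurable borel"
  unfolding radial_density_def by measurable

lemma measurable_gamma_density [measurable]: "gamma_density a \<in> borel_measurable borel"
  unfolding gamma_density_def by measurable

lemma emeasure_root_of_gamma:
  fixes R :: "'v \<Rightarrow> real"
  assumes \<alpha>: "0 < \<alpha>" and R [measurable]: "R \<in> borel_measurable N"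
    and pos: "AE \<omega> in N. 0 < R \<omega>"
    and gamma: "distributed N lborel (\<lambda>\<omega>. R \<omega> powr \<alpha>) (gamma_density (2 / \<alpha> * real (Suc n)))"
    and B [measurable]: "B \<in> sets borel"
  shows "emeasure N {\<omega>\<in>space N. R \<omega> \<in> B} = emeasure (density lborel (radial_density \<alpha> n)) B"
proof -
  let ?G = "gamma_density (2 / \<alpha> * real (Suc n))"
  let ?Q = "density lborel (radial_density \<alpha> n)"
  have eq: "emeasure (distr N borel R) (B \<inter> {a..b}) = emeasure ?Q (B \<inter> {a..b})"
    if ab: "0 < a" "a \<le> b" for a b
  proof -
    define f where "f y = ?G y * indicator B (y powr (1 / \<alpha>))" for y
    have f_meas [measurable]: "f \<in> borel_measurable borel" unfolding f_def by measurable
    let ?A = "{y \<in> {a powr \<alpha>..b powr \<alpha>}. y powr (1 / \<alpha>) \<in> B}"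
    have A: "?A \<in> sets lborel" by simp
    have "emeasure (distr N borel R) (B \<inter> {a..b}) = emeasure N (R -` (B \<inter> {a..b}) \<inter> space N)"
      by (rule emeasure_distr) auto
    also have "\<dots> = emeasure N ((\<lambda>\<omega>. R \<omega> powr \<alpha>) -` ?A \<inter> space N)"
    proof (rule emeasure_eq_AE)
      show "AE \<omega> in N. \<omega> \<in> R -` (B \<inter> {a..b}) \<inter> space N \<longleftrightarrow> \<omega> \<in> (\<lambda>\<omega>. R \<omega> powr \<alpha>) -` ?A \<inter> space N"
        using pos
      proof eventually_elim
        case (elim \<omega>)
        have "a powr \<alpha> \<le> R \<omega> powr \<alpha> \<longleftrightarrow> a \<le> R \<omega>" "R \<omega> powr \<alpha> \<le> b powr \<alpha> \<longleftrightarrow> R \<omega> \<le> b"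
          using powr_mono2[of \<alpha> a "R \<omega>"] powr_less_mono2[of \<alpha> "R \<omega>" a]
            powr_mono2[of \<alpha> "R \<omega>" b] powr_less_mono2[of \<alpha> b "R \<omega>"] elim \<alpha> ab
          by linarith+
        moreover have "(R \<omega> powr \<alpha>) powr (1 / \<alpha>) = R \<omega>"
          using elim \<alpha> by (simp add: powr_powr)
        ultimately show ?case by auto
      qed
    qed auto
    also have "\<dots> = (\<integral>\<^sup>+y. ennreal (?G y) * indicator ?A y \<partial>lborel)"
      by (rule distributed_emeasure[OF gamma A])
    also have "\<dots> = (\<integral>\<^sup>+y. ennreal (f y * indicator {a powr \<alpha>..b powr \<alpha>} y) \<partial>lborel)"
      by (rule nn_integral_cong) (auto simp: f_def indicator_def)
    also have "\<dots> = (\<integral>\<^sup>+r. ennreal (f (r powr \<alpha>) * (\<alpha> * r powr (\<alpha> - 1)) * indicator {a..b} r) \<partial>lborel)"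
    proof (rule nn_integral_substitution)
      show "set_borel_measurable borel {a powr \<alpha>..b powr \<alpha>} f"
        unfolding set_borel_measurable_def by measurable
      show "((\<lambda>r. r powr \<alpha>) has_real_derivative \<alpha> * r powr (\<alpha> - 1)) (at r)" if "r \<in> {a..b}" for r
        using that ab by (intro has_real_derivative_powr) auto
      show "continuous_on {a..b} (\<lambda>r. \<alpha> * r powr (\<alpha> - 1))"
        using ab by (intro continuous_intros) auto
    qed (use ab \<alpha> in auto)
    also have "\<dots> = (\<integral>\<^sup>+r. ennreal (radial_density \<alpha> n r) * indicator (B \<inter> {a..b}) r \<partial>lborel)"
    proof (rule nn_integral_cong)
      fix r :: real
      have "?G (r powr \<alpha>) * (\<alpha> * r powr (\<alpha> - 1)) = radial_density \<alpha> n r" "(r powr \<alpha>) powr (1 / \<alpha>) = r"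
        if "0 < r"
      proof -
        have e: "2 / \<alpha> * real (Suc n) = 2 / \<alpha> * real n + 2 / \<alpha>" by (simp add: distrib_left)
        have "(r powr \<alpha>) powr (2 / \<alpha> * real (Suc n) - 1) * r powr (\<alpha> - 1) =
            r powr (\<alpha> * (2 / \<alpha> * real (Suc n) - 1) + (\<alpha> - 1))"
          by (simp only: powr_powr powr_add)
        also have "\<alpha> * (2 / \<alpha> * real (Suc n) - 1) + (\<alpha> - 1) = real (2 * n + 1)"
          using \<alpha> by (simp add: field_simps)
        also have "r powr real (2 * n + 1) = r ^ (2 * n + 1)"
          using that by (simp only: powr_realpow)
        finally have p: "(r powr \<alpha>) powr (2 / \<alpha> * real (Suc n) - 1) * r powr (\<alpha> - 1) = r ^ (2 * n + 1)" .
        have "?G (r powr \<alpha>) * (\<alpha> * r powr (\<alpha> - 1)) = \<alpha> * ((r powr \<alpha>) powr (2 / \<alpha> * real (Suc n) - 1) *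
            r powr (\<alpha> - 1)) * exp (- (r powr \<alpha>)) / Gamma (2 / \<alpha> * real (Suc n))"
          using that by (simp add: gamma_density_def)
        then show "?G (r powr \<alpha>) * (\<alpha> * r powr (\<alpha> - 1)) = radial_density \<alpha> n r"
          unfolding p radial_density_def using that by (simp only: if_True e)
        show "(r powr \<alpha>) powr (1 / \<alpha>) = r" using that \<alpha> by (simp add: powr_powr)
      qed
      then show "ennreal (f (r powr \<alpha>) * (\<alpha> * r powr (\<alpha> - 1)) * indicator {a..b} r) =
          ennreal (radial_density \<alpha> n r) * indicator (B \<inter> {a..b}) r"
        using ab by (auto simp: f_def indicator_def)
    qed
    also have "\<dots> = emeasure ?Q (B \<inter> {a..b})"
      by (rule emeasure_density[symmetric]) auto
    finally show ?thesis .
  qed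
  have eq': "emeasure (distr N borel R) (B \<inter> {1 / real (Suc m)..real (Suc m)}) =
      emeasure ?Q (B \<inter> {1 / real (Suc m)..real (Suc m)})" for m
    by (rule eq) (auto simp: field_simps)
  have "emeasure N {\<omega>\<in>space N. R \<omega> \<in> B} = emeasure (distr N borel R) B"
    by (subst emeasure_distr) (auto intro!: arg_cong[where f="emeasure N"])
  also have "\<dots> = (SUP m. emeasure (distr N borel R) (B \<inter> {1 / real (Suc m)..real (Suc m)}))"
    using pos by (intro emeasure_eq_SUP_Icc) (simp_all add: AE_distr_iff)
  also have "\<dots> = emeasure ?Q B"
    unfolding eq' by (intro emeasure_eq_SUP_Icc[symmetric])
      (auto simp: AE_density radial_density_def)
  finally show ?thesis .
qed

section \<open>The orthogonal expansion of the Mittag-Leffler kernel\<close>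

text \<open>
  The functions in the orthogonal expansion of the Mittag-Leffler kernel, normalized so that they have
  norm \<open>1\<close> in the square-integrable functions on the plane.
\<close>
definition ml_fun :: "real \<Rightarrow> nat \<Rightarrow> complex \<Rightarrow> complex" where
  "ml_fun \<alpha> n z = complex_of_real
     (sqrt (\<alpha> / (2 * pi * Gamma (2 / \<alpha> * real n + 2 / \<alpha>))) * exp (- (norm z powr \<alpha>) / 2)) * z ^ n"

lemma measurable_ml_fun [measurable]: "ml_fun \<alpha> n \<in> borel_measurable borel"
  unfolding ml_fun_def by measurable

context
  fixes \<alpha> :: real
  assumes \<alpha>: "0 < \<alpha>"
begin

lemma Gamma_ml_pos: "0 < Gamma (2 / \<alpha> * real n + 2 / \<alpha>)"
  using \<alpha> by (intro Gamma_real_pos) (simp add: add_nonneg_pos)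

lemma mittag_leffler_kernel_eq_suminf:
  "mittag_leffler_kernel \<alpha> z w = (\<Sum>n. ml_fun \<alpha> n z * cnj (ml_fun \<alpha> n w))"
proof -
  let ?E = "complex_of_real (exp (- (norm z powr \<alpha>) / 2 - (norm w powr \<alpha>) / 2))"
  let ?G = "\<lambda>n. Gamma (2 / \<alpha> * real n + 2 / \<alpha>)"
  have term_eq: "ml_fun \<alpha> n z * cnj (ml_fun \<alpha> n w) =
      complex_of_real (\<alpha> / (2 * pi)) * ((z * cnj w) ^ n / complex_of_real (?G n)) * ?E" for n
  proof -
    have comm: "(p * q) * (p * r) = c * d" if "p * p = c" "q * r = d" for p q r c d :: real
      unfolding that[symmetric] by (simp only: mult_ac)
    have "sqrt (\<alpha> / (2 * pi * ?G n)) * sqrt (\<alpha> / (2 * pi * ?G n)) = \<alpha> / (2 * pi) / ?G n"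
      using \<alpha> Gamma_ml_pos[of n] by simp
    moreover have "exp (- (norm z powr \<alpha>) / 2) * exp (- (norm w powr \<alpha>) / 2) =
        exp (- (norm z powr \<alpha>) / 2 - (norm w powr \<alpha>) / 2)"
      by (simp add: exp_add[symmetric])
    ultimately have PQ: "(sqrt (\<alpha> / (2 * pi * ?G n)) * exp (- (norm z powr \<alpha>) / 2)) *
        (sqrt (\<alpha> / (2 * pi * ?G n)) * exp (- (norm w powr \<alpha>) / 2)) =
        \<alpha> / (2 * pi) / ?G n * exp (- (norm z powr \<alpha>) / 2 - (norm w powr \<alpha>) / 2)" (is "?P * ?Q = ?A * ?e")
      by (rule comm)
    have "ml_fun \<alpha> n z * cnj (ml_fun \<alpha> n w) = complex_of_real (?P * ?Q) * (z * cnj w) ^ n"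
      unfolding ml_fun_def complex_cnj_mult complex_cnj_complex_of_real complex_cnj_power
      by (simp only: of_real_mult power_mult_distrib mult_ac)
    also have "\<dots> = complex_of_real (\<alpha> / (2 * pi)) / complex_of_real (?G n) * ?E * (z * cnj w) ^ n"
      by (simp only: PQ of_real_mult of_real_divide)
    finally show ?thesis by simp
  qed
  have "summable (\<lambda>n. (z * cnj w) ^ n / complex_of_real (?G n))"
  proof (rule summable_norm_cancel)
    have "norm ((z * cnj w) ^ n / complex_of_real (?G n)) = (norm z * norm w) ^ n / ?G n" for n
      using Gamma_ml_pos[of n] by (simp add: norm_divide norm_power norm_mult)
    then show "summable (\<lambda>n. norm ((z * cnj w) ^ n / complex_of_real (?G n)))"
      using summable_power_div_Gamma[of "2 / \<alpha>" "norm z * norm w"] \<alpha> by simp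
  qed
  then show ?thesis
    unfolding term_eq mittag_leffler_kernel_def mittag_leffler_def
    by (rule sums_unique[OF sums_mult2[OF sums_mult[OF summable_sums]]])
qed

lemma norm_ml_fun_le:
  assumes "norm z \<le> r"
  shows "norm (ml_fun \<alpha> n z) \<le> sqrt (\<alpha> / (2 * pi * Gamma (2 / \<alpha> * real n + 2 / \<alpha>))) * r ^ n"
proof -
  let ?c = "sqrt (\<alpha> / (2 * pi * Gamma (2 / \<alpha> * real n + 2 / \<alpha>)))"
  have c: "0 \<le> ?c" using \<alpha> Gamma_ml_pos[of n] by simp
  have "norm (ml_fun \<alpha> n z) = (?c * exp (- (norm z powr \<alpha>) / 2)) * norm z ^ n"
    using c by (simp add: ml_fun_def norm_mult norm_power)
  also have "\<dots> \<le> (?c * 1) * r ^ n"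
    using c assms by (intro mult_mono mult_left_mono power_mono) auto
  finally show ?thesis by simp
qed

lemma summable_ml_fun_bound:
  assumes "0 \<le> r"
  shows "summable (\<lambda>n. (sqrt (\<alpha> / (2 * pi * Gamma (2 / \<alpha> * real n + 2 / \<alpha>))) * r ^ n)\<^sup>2)"
proof -
  have "(sqrt (\<alpha> / (2 * pi * Gamma (2 / \<alpha> * real n + 2 / \<alpha>))) * r ^ n)\<^sup>2 =
      \<alpha> / (2 * pi) * ((r\<^sup>2) ^ n / Gamma (2 / \<alpha> * real n + 2 / \<alpha>))" for n
    using \<alpha> Gamma_ml_pos[of n] by (simp add: power_mult_distrib power_mult[symmetric] mult.commute)
  then show ?thesis
    using summable_mult[OF summable_power_div_Gamma[of "2 / \<alpha>" "r\<^sup>2"], of "\<alpha> / (2 * pi)"] \<alpha> by simp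
qed

text \<open>
  The mass of the \<open>n\<close>-th function in a rotation-invariant set is the probability that the radius
  with index \<open>n + 1\<close> lies in the corresponding set of norms.
\<close>
lemma nn_integral_ml_fun:
  assumes B [measurable]: "B \<in> sets borel"
  shows "(\<integral>\<^sup>+z. ennreal ((norm (indicator (norm -` B) z * ml_fun \<alpha> n z))\<^sup>2) \<partial>lborel) =
    emeasure (density lborel (radial_density \<alpha> n)) B"
proof -
  let ?c = "\<alpha> / (2 * pi * Gamma (2 / \<alpha> * real n + 2 / \<alpha>))"
  define g where "g r = ?c * exp (- (r powr \<alpha>)) * r ^ (2 * n) * indicator B r" for r
  have [measurable]: "g \<in> borel_measurable borel" unfolding g_def by measurable
  have c: "0 \<le> ?c" using \<alpha> Gamma_ml_pos[of n] by simp
  have "(norm (indicator (norm -` B) z * ml_fun \<alpha> n z))\<^sup>2 = g (norm z)" for z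
  proof -
    have "(exp (- (norm z powr \<alpha>) / 2))\<^sup>2 = exp (- (norm z powr \<alpha>))"
      by (simp add: exp_double[symmetric])
    then show ?thesis
      using c by (auto simp: g_def ml_fun_def norm_mult norm_power power_mult_distrib indicator_def
          power_mult[symmetric] mult.commute)
  qed
  then have "(\<integral>\<^sup>+z. ennreal ((norm (indicator (norm -` B) z * ml_fun \<alpha> n z))\<^sup>2) \<partial>lborel) =
      (\<integral>\<^sup>+z. ennreal (g (norm (z :: complex))) \<partial>lborel)"
    by simp
  also have "\<dots> = (\<integral>\<^sup>+r. ennreal (g r) \<partial>distr lborel borel (norm :: complex \<Rightarrow> real))"
    by (subst nn_integral_distr) simp_all
  also have "\<dots> = (\<integral>\<^sup>+r. ennreal (2 * pi * r) * indicator {0..} r * ennreal (g r) \<partial>lborel)"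
    unfolding distr_lborel_norm_complex by (rule nn_integral_density) simp_all
  also have "\<dots> = (\<integral>\<^sup>+r. ennreal (radial_density \<alpha> n r) * indicator B r \<partial>lborel)"
  proof (rule nn_integral_cong)
    fix r :: real
    show "ennreal (2 * pi * r) * indicator {0..} r * ennreal (g r) =
        ennreal (radial_density \<alpha> n r) * indicator B r"
    proof (cases "0 < r")
      case True
      have "2 * pi * r * g r = radial_density \<alpha> n r * indicator B r"
        using True \<alpha> Gamma_ml_pos[of n] by (simp add: g_def radial_density_def field_simps)
      moreover have "ennreal (2 * pi * r) * ennreal (g r) = ennreal (2 * pi * r * g r)"
        using True by (simp add: ennreal_mult')
      ultimately show ?thesis using True by (auto simp: indicator_def)
    next
      case False
      then show ?thesis by (cases "r = 0") (auto simp: radial_density_def)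
    qed
  qed
  also have "\<dots> = emeasure (density lborel (radial_density \<alpha> n)) B"
    by (rule emeasure_density[symmetric]) auto
  finally show ?thesis .
qed

text \<open>
  Rotation by \<open>cis \<theta>\<close> multiplies the integrand by \<open>cis ((m - n) * \<theta>)\<close> and preserves the integral.
\<close>
lemma integral_ml_fun_orthogonal:
  assumes B [measurable]: "B \<in> sets borel" and mn: "m \<noteq> n"
  shows "(\<integral>z. (indicator (norm -` B) z * ml_fun \<alpha> m z) * cnj (indicator (norm -` B) z * ml_fun \<alpha> n z) \<partial>lborel) = 0"
proof -
  let ?F = "\<lambda>z. (indicator (norm -` B) z * ml_fun \<alpha> m z) * cnj (indicator (norm -` B) z * ml_fun \<alpha> n z)"
  \<comment> \<open>The angle is at most a quarter turn and makes the multiplier equal to \<open>\<i>\<close>.\<close>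
  define \<theta> where "\<theta> = pi / (2 * (real m - real n))"
  define u where "u = cis \<theta>"
  have nz: "real m - real n \<noteq> 0" using mn by simp
  have [measurable]: "norm -` B \<in> sets (borel :: complex measure)"
    using measurable_sets[of "norm :: complex \<Rightarrow> real" borel borel B] by simp
  have [measurable]: "cnj \<in> borel_measurable borel"
    by (intro borel_measurable_continuous_onI continuous_intros)
  have "1 \<le> \<bar>real m - real n\<bar>" using mn by linarith
  then have "\<bar>\<theta>\<bar> \<le> pi / 2" using nz by (simp add: \<theta>_def abs_mult field_simps)
  then have "0 \<le> cos \<theta>" by (intro cos_ge_zero) auto
  then have u: "norm u = 1" "Re u \<noteq> - 1" by (auto simp: u_def)
  have "u ^ m * cnj u ^ n = cis (real m * \<theta> - real n * \<theta>)"
    by (simp add: u_def Complex.DeMoivre cis_cnj cis_mult)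
  also have "real m * \<theta> - real n * \<theta> = (real m - real n) * \<theta>"
    by (rule left_diff_distrib[symmetric])
  also have "\<dots> = pi / 2"
  proof -
    have "d * (pi / (2 * d)) = pi / 2" if "d \<noteq> 0" for d :: real using that by simp
    from this[OF nz] show ?thesis unfolding \<theta>_def .
  qed
  finally have u_pow: "u ^ m * cnj u ^ n = \<i>" by simp
  have F_rot: "?F (u * z) = \<i> * ?F z" for z
  proof -
    have "?F (u * z) = (u ^ m * cnj u ^ n) * ?F z"
      using u(1) by (simp add: ml_fun_def norm_mult power_mult_distrib indicator_def)
    then show ?thesis unfolding u_pow .
  qed
  have "integral\<^sup>L lborel ?F = integral\<^sup>L (distr lborel borel ((*) u)) ?F"
    by (simp only: lborel_rotation[OF u])
  also have "\<dots> = (\<integral>z. ?F (u * z) \<partial>lborel)"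
    by (rule integral_distr) measurable
  also have "\<dots> = \<i> * integral\<^sup>L lborel ?F"
    unfolding F_rot by simp
  finally have "(1 - \<i>) * integral\<^sup>L lborel ?F = 0" by (simp add: algebra_simps)
  moreover have "1 - \<i> \<noteq> 0" by (simp add: complex_eq_iff)
  ultimately show ?thesis by simp
qed

lemma integral_ml_fun:
  assumes B [measurable]: "B \<in> sets borel"
  shows "(\<integral>z. (indicator (norm -` B) z * ml_fun \<alpha> m z) * cnj (indicator (norm -` B) z * ml_fun \<alpha> n z) \<partial>lborel) =
    of_bool (m = n) * complex_of_real (measure (density lborel (radial_density \<alpha> m)) B)"
proof (cases "m = n")
  case True
  have [measurable]: "norm -` B \<in> sets (borel :: complex measure)"
    using measurable_sets[of "norm :: complex \<Rightarrow> real" borel borel B] by simp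
  have "(\<integral>z. (indicator (norm -` B) z * ml_fun \<alpha> m z) * cnj (indicator (norm -` B) z * ml_fun \<alpha> m z) \<partial>lborel) =
      (\<integral>z. complex_of_real ((norm (indicator (norm -` B) z * ml_fun \<alpha> m z))\<^sup>2) \<partial>lborel)"
    by (simp only: complex_norm_square)
  also have "\<dots> = complex_of_real (\<integral>z. (norm (indicator (norm -` B) z * ml_fun \<alpha> m z))\<^sup>2 \<partial>lborel)"
    by (rule integral_complex_of_real)
  also have "(\<integral>z. (norm (indicator (norm -` B) z * ml_fun \<alpha> m z))\<^sup>2 \<partial>lborel) =
      enn2real (\<integral>\<^sup>+z. ennreal ((norm (indicator (norm -` B) z * ml_fun \<alpha> m z))\<^sup>2) \<partial>lborel)"
    by (rule integral_eq_nn_integral) auto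
  also have "\<dots> = measure (density lborel (radial_density \<alpha> m)) B"
    unfolding nn_integral_ml_fun[OF B] measure_def ..
  finally show ?thesis using True by simp
next
  case False
  then show ?thesis using integral_ml_fun_orthogonal[OF B] by simp
qed

end

section \<open>Equality of the laws\<close>

text \<open>
  The factorial moments of the number of points in the rotation-invariant set \<open>norm -` B\<close> are
  the limits of the sums over injective tuples of products of the radial probabilities of \<open>B\<close>.
\<close>
lemma ml_factorial_moments:
  fixes X :: "'w \<Rightarrow> complex set"
  assumes \<alpha>: "0 < \<alpha>"
    and dpp: "determinantal_point_process M lborel (mittag_leffler_kernel \<alpha>) X"
    and B [measurable]: "B \<in> sets borel" and bdd: "bounded B"
  obtains F where
    "\<And>k. (\<lambda>N. \<Sum>g\<in>inj_tuples k {..<N}. \<Prod>i<k. measure (density lborel (radial_density \<alpha> (g i))) B) \<longlonglongrightarrow> F k"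
    "\<And>k. (\<lambda>\<omega>. emeasure (count_space UNIV) (inj_tuples k (X \<omega> \<inter> norm -` B))) \<in> borel_measurable M"
    "\<And>k. (\<integral>\<^sup>+\<omega>. emeasure (count_space UNIV) (inj_tuples k (X \<omega> \<inter> norm -` B)) \<partial>M) = ennreal (F k)"
proof -
  from dpp have M: "prob_space M" and X: "X \<in> M \<rightarrow>\<^sub>M config_space"
    and loc_fin: "\<And>\<omega> C. \<omega> \<in> space M \<Longrightarrow> compact C \<Longrightarrow> finite (X \<omega> \<inter> C)"
    unfolding determinantal_point_process_def simple_point_process_def by blast+
  interpret M: prob_space M by fact
  obtain \<rho> where \<rho>: "joint_intensities M lborel X \<rho>"
    and \<rho>_det: "\<And>k x. 1 \<le> k \<Longrightarrow> x \<in> space (PiM {..<k} (\<lambda>_. lborel)) \<Longrightarrow> complex_of_real (\<rho> k x) =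
      Determinant.det (Matrix.mat k k (\<lambda>(i, j). mittag_leffler_kernel \<alpha> (x i) (x j)))"
    using dpp unfolding determinantal_point_process_def by blast
  define D where "D = (norm -` B :: complex set)"
  define l where "l n = measure (density lborel (radial_density \<alpha> n)) B" for n
  define \<psi> where "\<psi> n z = indicator D z * ml_fun \<alpha> n z" for n z
  obtain r where r: "0 < r" "\<And>x. x \<in> B \<Longrightarrow> norm x \<le> r"
    using bdd unfolding bounded_pos by auto
  define s where "s n = sqrt (\<alpha> / (2 * pi * Gamma (2 / \<alpha> * real n + 2 / \<alpha>))) * r ^ n" for n
  have D_ball: "D \<subseteq> cball 0 r"
    using r(2) by (fastforce simp: D_def)
  have D [measurable]: "D \<in> sets borel"
    using measurable_sets[of "norm :: complex \<Rightarrow> real" borel borel B] by (simp add: D_def)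
  have D_fin: "emeasure lborel D < \<infinity>"
    using emeasure_mono[OF D_ball, of lborel] emeasure_lborel_cball_finite[of "0 :: complex" r]
    by (simp add: le_less_trans)
  have \<psi>_meas: "\<psi> n \<in> borel_measurable lborel" for n
    unfolding \<psi>_def by simp
  have \<psi>_bound: "norm (\<psi> n z) \<le> s n * indicator D z" for n z
    using norm_ml_fun_le[OF \<alpha>, of z r n] D_ball by (auto simp: \<psi>_def s_def indicator_def dist_norm norm_mult)
  have \<psi>_orth: "(\<integral>z. \<psi> m z * cnj (\<psi> n z) \<partial>lborel) = of_bool (m = n) * complex_of_real (l m)" for m n
    unfolding \<psi>_def D_def l_def by (rule integral_ml_fun[OF \<alpha> B])
  have s_summable: "summable (\<lambda>n. (s n)\<^sup>2)"
    unfolding s_def using r(1) by (intro summable_ml_fun_bound[OF \<alpha>]) simp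
  define d where "d k x = Determinant.det (Matrix.mat k k (\<lambda>(i, j). \<Sum>n. \<psi> n (x i) * cnj (\<psi> n (x j))))"
    for k and x :: "nat \<Rightarrow> complex"
  define F where "F k = Re (integral\<^sup>L (PiM {..<k} (\<lambda>_. lborel)) (d k))" for k
  have d_int: "integrable (PiM {..<k} (\<lambda>_. lborel)) (d k)"
    and d_lim: "(\<lambda>N. \<Sum>g\<in>inj_tuples k {..<N}. \<Prod>i<k. complex_of_real (l (g i))) \<longlonglongrightarrow>
      integral\<^sup>L (PiM {..<k} (\<lambda>_. lborel)) (d k)" for k
    unfolding d_def
    using lborel.integrable_det_kernel[OF \<psi>_meas _ D_fin \<psi>_bound s_summable \<psi>_orth]
      lborel.LIMSEQ_integral_det_kernel[OF \<psi>_meas _ D_fin \<psi>_bound s_summable \<psi>_orth] by simp_all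
  have lim: "(\<lambda>N. \<Sum>g\<in>inj_tuples k {..<N}. \<Prod>i<k. l (g i)) \<longlonglongrightarrow> F k" for k
    using tendsto_Re[OF d_lim[of k]] unfolding F_def
    by (simp only: of_real_prod[symmetric] of_real_sum[symmetric] Re_complex_of_real)
  have l_nonneg: "0 \<le> l n" for n by (simp add: l_def)
  have kernel: "(\<Sum>n. \<psi> n z * cnj (\<psi> n w)) = indicator D z * indicator D w * mittag_leffler_kernel \<alpha> z w" for z w
    unfolding \<psi>_def mittag_leffler_kernel_eq_suminf[OF \<alpha>]
    by (cases "z \<in> D"; cases "w \<in> D") auto
  have d_eq: "d k x = complex_of_real (\<rho> k x * indicator (PiE {..<k} (\<lambda>_. D)) x)"
    if k: "1 \<le> k" and x: "x \<in> space (PiM {..<k} (\<lambda>_. lborel))" for k x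
  proof -
    have "x \<in> PiE {..<k} (\<lambda>_. D) \<longleftrightarrow> (\<forall>i<k. x i \<in> D)"
      using x by (auto simp: space_PiM PiE_iff)
    then show ?thesis
      unfolding d_def kernel det_restricted_kernel by (simp add: \<rho>_det[OF k x, symmetric])
  qed
  have cnt: "(\<lambda>\<omega>. emeasure (count_space UNIV) (inj_tuples k (X \<omega> \<inter> D))) \<in> borel_measurable M \<and>
      (\<integral>\<^sup>+\<omega>. emeasure (count_space UNIV) (inj_tuples k (X \<omega> \<inter> D)) \<partial>M) = ennreal (F k)" for k
  proof (cases "k = 0")
    case True
    have "F 0 = 1" by (rule sum_prod_inj_tuples_0[OF l_nonneg lim])
    moreover have "emeasure (count_space UNIV) (inj_tuples 0 S) = 1" for S :: "complex set"
      by (simp add: inj_tuples_def)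
    ultimately show ?thesis using True by (simp add: M.emeasure_space_1)
  next
    case False
    then have k: "1 \<le> k" by simp
    let ?P = "PiM {..<k} (\<lambda>_. lborel) :: (nat \<Rightarrow> complex) measure"
    have fin: "finite (X \<omega> \<inter> D)" if "\<omega> \<in> space M" for \<omega>
      by (rule finite_subset[OF _ loc_fin[OF that compact_cball[of 0 r]]]) (use D_ball in auto)
    note args = X \<rho> sets_lborel refining_complex_cell sets_complex_cell D finite_complex_cell[OF D_ball] fin k
    have "(\<integral>\<^sup>+x\<in>PiE {..<k} (\<lambda>_. D). ennreal (\<rho> k x) \<partial>?P) = (\<integral>\<^sup>+x. ennreal (Re (d k x)) \<partial>?P)"
      by (rule nn_integral_cong) (auto simp: d_eq[OF k] indicator_def)
    also have "\<dots> = ennreal (\<integral>x. Re (d k x) \<partial>?P)"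
    proof (rule nn_integral_eq_integral)
      have "0 \<le> \<rho> k x" if "x \<in> space ?P" for x
        using \<rho> k that unfolding joint_intensities_def by blast
      then show "AE x in ?P. 0 \<le> Re (d k x)"
        by (intro AE_I2) (simp add: d_eq[OF k])
    qed (rule integrable_Re[OF d_int])
    also have "(\<integral>x. Re (d k x) \<partial>?P) = F k"
      unfolding F_def by (rule integral_Re[OF d_int])
    finally show ?thesis
      using measurable_count_inj_tuples[OF args] factorial_moment_eq_integral[OF args] by simp
  qed
  show thesis
    by (rule that[of F]) (use lim cnt in \<open>simp_all add: l_def D_def\<close>)
qed

theorem corollary3p2:
  fixes \<alpha> :: real
    and M :: "'w measure" and X :: "'w \<Rightarrow> complex set"
    and N :: "'v measure" and R :: "nat \<Rightarrow> 'v \<Rightarrow> real"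
  assumes "\<alpha> > 0"
    and "determinantal_point_process M lborel (mittag_leffler_kernel \<alpha>) X"
    and "prob_space N"
    and "prob_space.indep_vars N (\<lambda>_. borel) R {1..}"
    and "\<And>k. k \<ge> 1 \<Longrightarrow> AE \<omega> in N. R k \<omega> > 0"
    and "\<And>k. k \<ge> 1 \<Longrightarrow>
           distributed N lborel (\<lambda>\<omega>. R k \<omega> powr \<alpha>) (gamma_density (2 / \<alpha> * real k))"
  shows "(\<lambda>\<omega>. norm ` X \<omega>) \<in> M \<rightarrow>\<^sub>M config_space \<and>
         (\<lambda>\<omega>. {R k \<omega> | k. k \<ge> 1}) \<in> N \<rightarrow>\<^sub>M config_space \<and>
         distr M config_space (\<lambda>\<omega>. norm ` X \<omega>) =
         distr N config_space (\<lambda>\<omega>. {R k \<omega> | k. k \<ge> 1})"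
proof -
  interpret N: prob_space N by fact
  have M: "prob_space M" and X: "X \<in> M \<rightarrow>\<^sub>M config_space"
    using assms(2) unfolding determinantal_point_process_def simple_point_process_def by blast+
  interpret M: prob_space M by fact
  have R [measurable]: "R (Suc n) \<in> borel_measurable N" for n
    using assms(4) unfolding N.indep_vars_def by auto
  have X_void: "{\<omega>\<in>space M. norm ` X \<omega> \<inter> B = {}} = {\<omega>\<in>space M. X \<omega> \<inter> norm -` B = {}}" for B
    by auto
  have R_void: "{\<omega>\<in>space N. {R k \<omega> | k. k \<ge> 1} \<inter> B = {}} =
      {\<omega>\<in>space N. {n. \<omega> \<in> R (Suc n) -` B \<inter> space N} = {}}" for B
  proof -
    have "{R k \<omega> | k. k \<ge> 1} = range (\<lambda>n. R (Suc n) \<omega>)" for \<omega>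
    proof -
      have "{1 :: nat..} = range Suc" by (auto simp: image_iff Suc_le_eq gr0_conv_Suc)
      then have "R k \<omega> \<in> range (\<lambda>n. R (Suc n) \<omega>)" if "1 \<le> k" for k
        using that by (cases k) auto
      then show ?thesis by auto
    qed
    then show ?thesis by auto
  qed
  have X_meas: "(\<lambda>\<omega>. norm ` X \<omega>) \<in> M \<rightarrow>\<^sub>M config_space"
  proof (rule measurable_config_space_real_void)
    fix B :: "real set" assume [measurable]: "B \<in> sets borel"
    have "norm -` B \<in> sets (borel :: complex measure)"
      using measurable_sets[of "norm :: complex \<Rightarrow> real" borel borel B] by simp
    from measurable_sets[OF X sets_config_space_void[OF this]]
    have "X -` {A. A \<inter> norm -` B = {}} \<inter> space M \<in> sets M" .
    also have "X -` {A. A \<inter> norm -` B = {}} \<inter> space M = {\<omega>\<in>space M. norm ` X \<omega> \<inter> B = {}}"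
      by auto
    finally show "{\<omega>\<in>space M. norm ` X \<omega> \<inter> B = {}} \<in> sets M" .
  qed
  have R_meas: "(\<lambda>\<omega>. {R k \<omega> | k. k \<ge> 1}) \<in> N \<rightarrow>\<^sub>M config_space"
  proof (rule measurable_config_space_real_void)
    fix B :: "real set" assume [measurable]: "B \<in> sets borel"
    have "{\<omega>\<in>space N. \<forall>n. R (Suc n) \<omega> \<notin> B} \<in> sets N" by measurable
    moreover have "{\<omega>\<in>space N. {n. \<omega> \<in> R (Suc n) -` B \<inter> space N} = {}} = {\<omega>\<in>space N. \<forall>n. R (Suc n) \<omega> \<notin> B}"
      by auto
    ultimately show "{\<omega>\<in>space N. {R k \<omega> | k. k \<ge> 1} \<inter> B = {}} \<in> sets N"
      unfolding R_void by simp
  qed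
  have "distr M config_space (\<lambda>\<omega>. norm ` X \<omega>) = distr N config_space (\<lambda>\<omega>. {R k \<omega> | k. k \<ge> 1})"
  proof (rule distr_config_space_real_eqI[OF M X_meas R_meas])
    fix B :: "real set" assume B [measurable]: "B \<in> sets borel" and bdd: "bounded B"
    define A where "A n = R (Suc n) -` B \<inter> space N" for n
    obtain F where
      lim: "\<And>k. (\<lambda>N. \<Sum>g\<in>inj_tuples k {..<N}. \<Prod>i<k. measure (density lborel (radial_density \<alpha> (g i))) B) \<longlonglongrightarrow> F k"
      and X_cnt: "\<And>k. (\<lambda>\<omega>. emeasure (count_space UNIV) (inj_tuples k (X \<omega> \<inter> norm -` B))) \<in> borel_measurable M"
      and X_moment: "\<And>k. (\<integral>\<^sup>+\<omega>. emeasure (count_space UNIV) (inj_tuples k (X \<omega> \<inter> norm -` B)) \<partial>M) = ennreal (F k)"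
      using ml_factorial_moments[OF assms(1,2) B bdd] by blast
    have F: "\<And>k. 0 \<le> F k" "summable (\<lambda>k. F k / fact k)"
      using sum_prod_inj_tuples_nonneg[OF _ lim] sum_prod_inj_tuples_summable[OF _ lim] by simp_all
    have prob_A: "N.prob (A n) = measure (density lborel (radial_density \<alpha> n)) B" for n
    proof -
      have "A n = {\<omega>\<in>space N. R (Suc n) \<omega> \<in> B}" by (auto simp: A_def)
      then have "emeasure N (A n) = emeasure (density lborel (radial_density \<alpha> n)) B"
        using emeasure_root_of_gamma[OF assms(1) R assms(5)[of "Suc n"] assms(6)[of "Suc n"] B] by simp
      then show ?thesis by (simp add: measure_def)
    qed
    have indep: "N.indep_events A UNIV"
      unfolding N.indep_events_def
    proof (intro conjI allI impI)
      show "A ` UNIV \<subseteq> N.events" by (auto simp: A_def)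
      fix J :: "nat set" assume J: "J \<noteq> {}" "finite J"
      have "N.prob (\<Inter>i\<in>Suc ` J. R i -` B \<inter> space N) = (\<Prod>i\<in>Suc ` J. N.prob (R i -` B \<inter> space N))"
        using J by (intro N.indep_varsD[OF assms(4)]) auto
      then show "N.prob (\<Inter>j\<in>J. A j) = (\<Prod>j\<in>J. N.prob (A j))"
        unfolding A_def image_image
        by (simp only: prod.reindex[OF inj_on_subset[OF inj_Suc subset_UNIV]] comp_def)
    qed
    have lim': "(\<lambda>n. \<Sum>g\<in>inj_tuples k {..<n}. \<Prod>i<k. N.prob (A (g i))) \<longlonglongrightarrow> F k" for k
      unfolding prob_A by (rule lim)
    have "emeasure M {\<omega>\<in>space M. norm ` X \<omega> \<inter> B = {}} = ennreal (\<Sum>k. (-1) ^ k * F k / fact k)"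
      unfolding X_void by (rule M.emeasure_empty_eq_alternating_sum[OF X_cnt X_moment F])
    also have "\<dots> = emeasure N {\<omega>\<in>space N. {n. \<omega> \<in> A n} = {}}"
      by (rule N.emeasure_empty_eq_alternating_sum[OF N.measurable_count_indep_events[OF indep lim']
            N.factorial_moment_indep_events[OF indep lim'] F, symmetric])
    also have "\<dots> = emeasure N {\<omega>\<in>space N. {R k \<omega> | k. k \<ge> 1} \<inter> B = {}}"
      unfolding R_void A_def ..
    finally show "emeasure M {\<omega>\<in>space M. norm ` X \<omega> \<inter> B = {}} =
        emeasure N {\<omega>\<in>space N. {R k \<omega> | k. k \<ge> 1} \<inter> B = {}}" .
  qed
  with X_meas R_meas show ?thesis by blast
qed

end
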